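(* Consider the EDNR problem on grids where $d_v=1$ for all non-root vertices $v\neq r$, $r_e=1$ for all edges $e$, and the root $r$ is located at a corner of the grid. Then the problem admits a polynomial-time approximation algorithm within the factor $9/8+o(1)$, i.e., an algorithm that outputs a spanning tree whose loss is at most $(9/8+o(1))$ times the minimum loss, where $o(1)$ denotes a quantity tending to $0$ as the smaller side length of the grid tends to infinity.
   Context: The EDNR problem: given a connected undirected graph $G=(V,E)$ with root $r\in V$, demands $d_v\ge 0$ ($v\ne r$) and resistances $r_e\ge 0$ ($e\in E$), find a spanning tree $T=(V,F)$ minimizing $L(T)=\sum_{e\in F} r_e\big(\sum_{v\in D_T(e)} d_v\big)^2$, where $D_T(e)$ is the vertex set of the component of $T-e$ not containing $r$. An $n\times m$-grid has vertex set $\{(i,j): 0\le i\le n-1,\ 0\le j\le m-1\}$ and edges $\{(i,j),(i',j')\}$ with $|i-i'|+|j-j'|=1$; a corner is one of $(0,0),(0,m-1),(n-1,0),(n-1,m-1)$. *)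

theory Defs
  imports Complex_Main "HOL-Computational_Algebra.Polynomial"
begin

section \<open>Undirected graphs and spanning trees\<close>

text \<open>
  A graph is given by its vertex set \<open>V\<close> and its edge set \<open>E\<close>, an edge being the two-element set
  of its endpoints. The trees of the AFP entry \<open>Graph_Theory\<close> are not usable here: in the symmetric
  digraph of an undirected graph every edge already forms a directed cycle of length two.
\<close>

definition adj :: "'v set set \<Rightarrow> ('v \<times> 'v) set" where
  "adj E = {(u, v). u \<noteq> v \<and> {u, v} \<in> E}"

definition joined :: "'v set \<Rightarrow> 'v set set \<Rightarrow> ('v \<times> 'v) set" where
  "joined V E = {(u, v). u \<in> V \<and> v \<in> V \<and> (u, v) \<in> (adj E)\<^sup>*}"

definition graph_connected :: "'v set \<Rightarrow> 'v set set \<Rightarrow> bool" where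
  "graph_connected V E \<longleftrightarrow> V \<noteq> {} \<and> (\<forall>u\<in>V. \<forall>v\<in>V. (u, v) \<in> joined V E)"

definition graph_components :: "'v set \<Rightarrow> 'v set set \<Rightarrow> 'v set set" where
  "graph_components V E = V // joined V E"

definition is_graph_cycle :: "'v set set \<Rightarrow> 'v list \<Rightarrow> bool" where
  "is_graph_cycle E xs \<longleftrightarrow> 3 \<le> length xs \<and> distinct xs \<and>
     (\<forall>i<length xs. {xs ! i, xs ! (Suc i mod length xs)} \<in> E)"

definition spanning_tree :: "'v set \<Rightarrow> 'v set set \<Rightarrow> 'v set set \<Rightarrow> bool" where
  "spanning_tree V E F \<longleftrightarrow> F \<subseteq> E \<and> graph_connected V F \<and> \<not> (\<exists>xs. is_graph_cycle F xs)"


section \<open>The EDNR problem\<close>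

definition far_side :: "'v set \<Rightarrow> 'v \<Rightarrow> 'v set set \<Rightarrow> 'v set \<Rightarrow> 'v set" where
  "far_side V r F e = (THE C. C \<in> graph_components V (F - {e}) \<and> r \<notin> C)"

definition ednr_loss ::
  "'v set \<Rightarrow> 'v \<Rightarrow> ('v \<Rightarrow> real) \<Rightarrow> ('v set \<Rightarrow> real) \<Rightarrow> 'v set set \<Rightarrow> real" where
  "ednr_loss V r d res F = (\<Sum>e\<in>F. res e * (\<Sum>v\<in>far_side V r F e. d v)\<^sup>2)"

definition ednr_opt ::
  "'v set \<Rightarrow> 'v set set \<Rightarrow> 'v \<Rightarrow> ('v \<Rightarrow> real) \<Rightarrow> ('v set \<Rightarrow> real) \<Rightarrow> real" where
  "ednr_opt V E r d res = Min (ednr_loss V r d res ` {F. spanning_tree V E F})"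


section \<open>Grids\<close>

definition grid_verts :: "nat \<Rightarrow> nat \<Rightarrow> (nat \<times> nat) set" where
  "grid_verts n m = {..<n} \<times> {..<m}"

definition grid_edges :: "nat \<Rightarrow> nat \<Rightarrow> (nat \<times> nat) set set" where
  "grid_edges n m = {{(i, j), (i', j')} | i j i' j'.
     (i, j) \<in> grid_verts n m \<and> (i', j') \<in> grid_verts n m \<and>
     \<bar>int i - int i'\<bar> + \<bar>int j - int j'\<bar> = 1}"

definition grid_corners :: "nat \<Rightarrow> nat \<Rightarrow> (nat \<times> nat) set" where
  "grid_corners n m = {(0, 0), (0, m - 1), (n - 1, 0), (n - 1, m - 1)}"


section \<open>Algorithms and running time\<close>

text \<open>
  Algorithms are programs of a structured random access machine: natural-number registers, an
  indirectly addressed memory that initially holds the input, and an append-only output. Every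
  operator, register access and memory access costs one time unit, and so does every executed
  command or test. Multiplication is deliberately not an operation: with addition, truncated
  subtraction and halving only, the bit length of the stored numbers grows by at most one per
  time unit, so polynomial time on this machine is polynomial time on a Turing machine.
\<close>

datatype aexp =
    Const nat
  | Reg nat
  | Mem aexp
  | Plus aexp aexp
  | Minus aexp aexp
  | Half aexp

datatype com =
    Skip
  | Assign nat aexp
  | Store aexp aexp
  | Write aexp
  | Seq com com
  | IfNZ aexp com com
  | WhileNZ aexp com

record ram =
  regs :: "nat \<Rightarrow> nat"
  mem :: "nat \<Rightarrow> nat"
  out :: "nat list"

primrec aval :: "aexp \<Rightarrow> ram \<Rightarrow> nat" where
  "aval (Const k) s = k"
| "aval (Reg x) s = regs s x"
| "aval (Mem a) s = mem s (aval a s)"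
| "aval (Plus a b) s = aval a s + aval b s"
| "aval (Minus a b) s = aval a s - aval b s"
| "aval (Half a) s = aval a s div 2"

primrec acost :: "aexp \<Rightarrow> nat" where
  "acost (Const k) = 1"
| "acost (Reg x) = 1"
| "acost (Mem a) = acost a + 1"
| "acost (Plus a b) = acost a + acost b + 1"
| "acost (Minus a b) = acost a + acost b + 1"
| "acost (Half a) = acost a + 1"

text \<open>\<open>exec c s t s'\<close>: started in state \<open>s\<close>, program \<open>c\<close> halts in state \<open>s'\<close> after \<open>t\<close> time units.\<close>

inductive exec :: "com \<Rightarrow> ram \<Rightarrow> nat \<Rightarrow> ram \<Rightarrow> bool" where
  Skip: "exec Skip s 1 s"
| Assign: "exec (Assign x a) s (acost a + 1) (s\<lparr>regs := (regs s)(x := aval a s)\<rparr>)"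
| Store: "exec (Store a b) s (acost a + acost b + 1) (s\<lparr>mem := (mem s)(aval a s := aval b s)\<rparr>)"
| Write: "exec (Write a) s (acost a + 1) (s\<lparr>out := out s @ [aval a s]\<rparr>)"
| Seq: "exec c s t s' \<Longrightarrow> exec c' s' t' s'' \<Longrightarrow> exec (Seq c c') s (t + t') s''"
| IfTrue: "aval a s \<noteq> 0 \<Longrightarrow> exec c s t s' \<Longrightarrow> exec (IfNZ a c c') s (acost a + 1 + t) s'"
| IfFalse: "aval a s = 0 \<Longrightarrow> exec c' s t s' \<Longrightarrow> exec (IfNZ a c c') s (acost a + 1 + t) s'"
| WhileTrue: "aval a s \<noteq> 0 \<Longrightarrow> exec c s t s' \<Longrightarrow> exec (WhileNZ a c) s' t' s'' \<Longrightarrow>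
    exec (WhileNZ a c) s (acost a + 1 + t + t') s''"
| WhileFalse: "aval a s = 0 \<Longrightarrow> exec (WhileNZ a c) s (acost a + 1) s"

inductive_cases SkipE: "exec Skip s t s'"
inductive_cases AssignE: "exec (Assign x a) s t s'"
inductive_cases StoreE: "exec (Store a b) s t s'"
inductive_cases WriteE: "exec (Write a) s t s'"
inductive_cases SeqE: "exec (Seq c c') s t s'"
inductive_cases IfE: "exec (IfNZ a c c') s t s'"
inductive_cases WhileE: "exec (WhileNZ a c) s t s'"

lemma exec_deterministic:
  assumes "exec c s t s'" and "exec c s u s''"
  shows "u = t \<and> s'' = s'"
  using assms
proof (induction arbitrary: u s'' rule: exec.induct)
  case (Skip s) then show ?case by (rule SkipE) simp
next
  case (Assign x a s) then show ?case by (rule AssignE) simp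
next
  case (Store a b s) then show ?case by (rule StoreE) simp
next
  case (Write a s) then show ?case by (rule WriteE) simp
next
  case (Seq c s t s' c' t' s2)
  from Seq.prems obtain u1 s1 u2 where
    1: "exec c s u1 s1" and 2: "exec c' s1 u2 s''" and u: "u = u1 + u2"
    by (rule SeqE)
  from Seq.IH(1)[OF 1] have eq: "u1 = t" "s1 = s'" by simp_all
  from Seq.IH(2)[OF 2[unfolded eq]] show ?case using eq u by simp
next
  case (IfTrue a s c t s' c')
  from IfTrue.prems obtain u1 where 1: "exec c s u1 s''" and u: "u = acost a + 1 + u1"
    by (rule IfE) (use IfTrue.hyps in simp_all)
  from IfTrue.IH[OF 1] show ?case using u by simp
next
  case (IfFalse a s c' t s' c)
  from IfFalse.prems obtain u1 where 1: "exec c' s u1 s''" and u: "u = acost a + 1 + u1"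
    by (rule IfE) (use IfFalse.hyps in simp_all)
  from IfFalse.IH[OF 1] show ?case using u by simp
next
  case (WhileTrue a s c t s' t' s2)
  from WhileTrue.prems obtain u1 s1 u2 where
    1: "exec c s u1 s1" and 2: "exec (WhileNZ a c) s1 u2 s''" and u: "u = acost a + 1 + u1 + u2"
    by (rule WhileE) (use WhileTrue.hyps in simp_all)
  from WhileTrue.IH(1)[OF 1] have eq: "u1 = t" "s1 = s'" by simp_all
  from WhileTrue.IH(2)[OF 2[unfolded eq]] show ?case using eq u by simp
next
  case (WhileFalse a s c)
  from WhileFalse.prems show ?case by (rule WhileE) (use WhileFalse.hyps in simp_all)
qed

definition initial :: "nat list \<Rightarrow> ram" where
  "initial xs = \<lparr>regs = (\<lambda>_. 0), mem = (\<lambda>a. if a < length xs then xs ! a else 0), out = []\<rparr>"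

definition halts_with :: "com \<Rightarrow> nat list \<Rightarrow> nat \<Rightarrow> nat list \<Rightarrow> bool" where
  "halts_with c xs t ys \<longleftrightarrow> (\<exists>s. exec c (initial xs) t s \<and> out s = ys)"


section \<open>Encoding of instances and solutions\<close>

definition edge_listing :: "('v \<times> 'v) list \<Rightarrow> 'v set set \<Rightarrow> bool" where
  "edge_listing es E \<longleftrightarrow>
     distinct (map (\<lambda>(u, v). {u, v}) es) \<and> set (map (\<lambda>(u, v). {u, v}) es) = E"

definition encode_vert :: "nat \<times> nat \<Rightarrow> nat list" where
  "encode_vert v = [fst v, snd v]"

definition encode_edges :: "((nat \<times> nat) \<times> (nat \<times> nat)) list \<Rightarrow> nat list" where
  "encode_edges es = concat (map (\<lambda>(u, v). encode_vert u @ encode_vert v) es)"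

definition encode_rooted_graph ::
  "(nat \<times> nat) list \<Rightarrow> ((nat \<times> nat) \<times> (nat \<times> nat)) list \<Rightarrow> nat \<times> nat \<Rightarrow> nat list" where
  "encode_rooted_graph vs es r =
     [length vs, length es] @ encode_vert r @ concat (map encode_vert vs) @ encode_edges es"

end

theory Submission
  imports Defs "HOL-Analysis.Convex" "HOL-Library.Discrete_Functions"
begin

text \<open>
  Lower bound. In a spanning tree every vertex at distance \<open>k\<close> from the root has a single parent edge, and
  every vertex at distance at least \<open>k\<close> descends from one of them. By Cauchy--Schwarz the loss is at least
  the sum over \<open>k \<ge> 1\<close> of \<open>S k\<^sup>2 / l k\<close>, where \<open>l k\<close> vertices have distance \<open>k\<close> and \<open>S k\<close> have distance at least \<open>k\<close>.

  Upper bound. Near the root corner the diagonals have \<open>1, 2, 3, \<dots>\<close> cells, and a tree can split one branch per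
  diagonal. Halving the branches in turn, \<open>k = p + b\<close> cells with \<open>p\<close> a power of two and \<open>b < p\<close> carry \<open>2 b\<close> shares
  \<open>1 / (2 p)\<close> and \<open>p - b\<close> shares \<open>1 / p\<close>; with \<open>\<beta> = b / p\<close> this costs \<open>(1 + \<beta>) (1 - \<beta> / 2) \<le> 9 / 8\<close> times the
  lower bound of the diagonal. Once a triangle of side \<open>K = 2 ^ q\<close> slightly smaller than \<open>n\<close>
  is left, each of its \<open>K\<close> branches feeds a block of about \<open>n / K\<close> full rows, so all branches have nearly equal
  demand. The rows themselves cost as much as the lower bound on the diagonals \<open>n \<le> k < m\<close>, up to \<open>O(N\<^sup>2)\<close>
  with \<open>N = n m\<close>, and this and all other errors are negligible against the \<open>N\<^sup>2 ln K\<close> of the triangle.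
\<close>

section \<open>Rooted spanning trees\<close>

lemma sym_adj: "sym (adj E)"
  by (auto simp: adj_def sym_def insert_commute)

lemma equiv_joined: "equiv V (joined V E)"
proof (rule equivI)
  show "joined V E \<subseteq> V \<times> V" by (auto simp: joined_def)
  show "refl_on V (joined V E)" by (auto simp: joined_def refl_on_def)
  show "sym (joined V E)"
    using sym_rtrancl[OF sym_adj, of E] by (auto simp: joined_def sym_def)
  show "trans (joined V E)" by (auto simp: joined_def intro!: transI)
qed

text \<open>A path is extended at its front; if the new vertex already occurs on it, the suffix
  starting there is taken instead, which keeps the path simple.\<close>

lemma rtrancl_imp_simple_path:
  assumes "(x, y) \<in> R\<^sup>*"
  shows "\<exists>xs. xs \<noteq> [] \<and> hd xs = x \<and> last xs = y \<and> distinct xs \<and>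
           successively (\<lambda>a b. (a, b) \<in> R) xs"
  using assms
proof (induction rule: converse_rtrancl_induct)
  case base
  show ?case by (rule exI[of _ "[y]"]) simp
next
  case (step x z)
  then obtain xs where xs: "xs \<noteq> []" "hd xs = z" "last xs = y" "distinct xs"
    "successively (\<lambda>a b. (a, b) \<in> R) xs" by blast
  show ?case
  proof (cases "x \<in> set xs")
    case True
    then obtain ys zs where "xs = ys @ x # zs" by (meson split_list)
    with xs show ?thesis
      by (intro exI[of _ "x # zs"]) (auto simp: successively_append_iff)
  next
    case False
    with xs step.hyps(1) show ?thesis
      by (intro exI[of _ "x # xs"]) (auto simp: successively_Cons)
  qed
qed

text \<open>A simple path from \<open>x\<close> to \<open>y\<close> avoiding the edge would close up
  with it to a cycle. It has at least three vertices, since a path on two would use the removed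
  edge.\<close>

lemma acyclic_edge_is_bridge:
  assumes "\<not> (\<exists>xs. is_graph_cycle F xs)" "{x, y} \<in> F" "x \<noteq> y"
  shows "(x, y) \<notin> (adj (F - {{x, y}}))\<^sup>*"
proof
  assume "(x, y) \<in> (adj (F - {{x, y}}))\<^sup>*"
  then obtain xs where xs: "xs \<noteq> []" "hd xs = x" "last xs = y" "distinct xs"
    "successively (\<lambda>a b. (a, b) \<in> adj (F - {{x, y}})) xs"
    using rtrancl_imp_simple_path by metis
  have step: "{xs ! i, xs ! Suc i} \<in> F - {{x, y}}" if "Suc i < length xs" for i
    using xs(5) that by (auto simp: successively_conv_nth adj_def)
  have len: "3 \<le> length xs"
  proof (rule ccontr)
    assume "\<not> 3 \<le> length xs"
    with xs(1) consider "length xs = 1" | "length xs = 2"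
      by (cases "length xs" rule: nat.exhaust) fastforce+
    then show False
    proof cases
      case 1
      with xs(2,3) assms(3) show False by (cases xs) auto
    next
      case 2
      then have "xs = [x, y]"
        using xs(2,3) by (cases xs; cases "tl xs") auto
      with step[of 0] show False by simp
    qed
  qed
  have "{xs ! i, xs ! (Suc i mod length xs)} \<in> F" if "i < length xs" for i
  \<comment> \<open>The index wraps around exactly at the pair that is closed by
    \<open>{x, y}\<close>.\<close>
  proof (cases "Suc i = length xs")
    case True
    then have "xs ! i = y" "xs ! 0 = x"
      using xs(1-3) by (auto simp: last_conv_nth hd_conv_nth simp flip: True)
    with True assms(2) show ?thesis by (simp add: insert_commute)
  next
    case False
    with that step[of i] show ?thesis by simp
  qed
  with len xs(4) have "is_graph_cycle F xs" by (auto simp: is_graph_cycle_def)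
  with assms(1) show False by blast
qed

section \<open>Rooted trees given by parent functions, and their loss\<close>

text \<open>Serves both bounds: \<open>rank\<close> is the distance to the root inside an arbitrary
  spanning tree, and the distance from the root corner for the explicit tree.\<close>

locale parent_map =
  fixes V :: "'v set" and r :: 'v and par :: "'v \<Rightarrow> 'v" and rank :: "'v \<Rightarrow> nat"
  assumes finite_V: "finite V"
    and root_in: "r \<in> V"
    and par_in: "v \<in> V \<Longrightarrow> v \<noteq> r \<Longrightarrow> par v \<in> V"
    and rank_par: "v \<in> V \<Longrightarrow> v \<noteq> r \<Longrightarrow> rank (par v) < rank v"
begin

definition up :: "('v \<times> 'v) set" where
  "up = {(v, par v) | v. v \<in> V - {r}}"

definition desc :: "'v \<Rightarrow> 'v set" where
  "desc v = {u \<in> V. (u, v) \<in> up\<^sup>*}"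

definition parent_edges :: "'v set set" where
  "parent_edges = (\<lambda>v. {v, par v}) ` (V - {r})"

text \<open>Two different vertices with the same parent edge would be each other's parents, against
  the ranks.\<close>

lemma parent_edge_inj: "inj_on (\<lambda>v. {v, par v}) (V - {r})"
proof (rule inj_onI)
  fix v w assume "v \<in> V - {r}" "w \<in> V - {r}" "{v, par v} = {w, par w}"
  then show "v = w"
    using rank_par[of v] rank_par[of w] by (auto simp: doubleton_eq_iff)
qed

lemma up_rank: "(u, v) \<in> up\<^sup>* \<Longrightarrow> rank v \<le> rank u"
proof (induction rule: rtrancl_induct)
  case (step y z)
  then show ?case using rank_par by (fastforce simp: up_def)
qed simp

lemma up_root: "u \<in> V \<Longrightarrow> (u, r) \<in> up\<^sup>*"
proof (induction "rank u" arbitrary: u rule: less_induct)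
  case less
  show ?case
  proof (cases "u = r")
    case False
    with less have "(par u, r) \<in> up\<^sup>*" using rank_par par_in by blast
    moreover have "(u, par u) \<in> up" using False less by (auto simp: up_def)
    ultimately show ?thesis by (rule converse_rtrancl_into_rtrancl[rotated])
  qed simp
qed

lemma desc_finite: "finite (desc v)"
  using finite_V by (simp add: desc_def)

text \<open>The ascent from \<open>u\<close> to \<open>v\<close> uses only parent edges of vertices
  ranked above \<open>v\<close>, hence not the removed one.\<close>

lemma desc_below:
  assumes "u \<in> desc v" "v \<in> V - {r}" "parent_edges \<subseteq> F"
  shows "(u, v) \<in> (adj (F - {{v, par v}}))\<^sup>*"
proof -
  have "(u, v) \<in> up\<^sup>*" using assms by (simp add: desc_def)
  then show ?thesis
  proof (induction rule: converse_rtrancl_induct)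
    case (step y z)
    from step.hyps(1) have z: "z = par y" "y \<in> V - {r}" by (auto simp: up_def)
    have "rank v \<le> rank z" using step.hyps(2) by (rule up_rank)
    moreover have "rank z < rank y" using z rank_par by simp
    ultimately have "y \<noteq> v" "y \<noteq> z" by auto
    then have "{y, par y} \<noteq> {v, par v}"
      using inj_onD[OF parent_edge_inj, of y v] z assms(2) by blast
    with z assms(3) \<open>y \<noteq> z\<close> have "(y, z) \<in> adj (F - {{v, par v}})"
      by (auto simp: adj_def parent_edges_def)
    with step.IH show ?case by (rule converse_rtrancl_into_rtrancl[rotated])
  qed simp
qed

text \<open>The ascent from \<open>u\<close> to the root never visits \<open>v\<close>, the only
  vertex whose parent edge is removed.\<close>

lemma non_desc_root:
  assumes "u \<in> V - desc v" "v \<in> V - {r}" "parent_edges \<subseteq> F"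
  shows "(u, r) \<in> (adj (F - {{v, par v}}))\<^sup>*"
  using assms(1)
proof (induction "rank u" arbitrary: u rule: less_induct)
  case less
  show ?case
  proof (cases "u = r")
    case False
    have ru: "rank (par u) < rank u" and pV: "par u \<in> V"
      using False less.prems rank_par par_in by auto
    have st: "(u, par u) \<in> up" using False less.prems by (auto simp: up_def)
    have "par u \<notin> desc v"
    proof
      assume "par u \<in> desc v"
      then have "(u, v) \<in> up\<^sup>*"
        using st by (auto simp: desc_def intro: converse_rtrancl_into_rtrancl)
      with less.prems show False by (simp add: desc_def)
    qed
    with less.hyps[OF ru] pV have IH: "(par u, r) \<in> (adj (F - {{v, par v}}))\<^sup>*" by blast
    have "u \<noteq> v" using less.prems by (auto simp: desc_def)
    then have "{u, par u} \<noteq> {v, par v}"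
      using inj_onD[OF parent_edge_inj, of u v] False less.prems assms(2) by blast
    with assms(3) False less.prems ru have "(u, par u) \<in> adj (F - {{v, par v}})"
      by (auto simp: adj_def parent_edges_def)
    with IH show ?thesis by (rule converse_rtrancl_into_rtrancl[rotated])
  qed simp
qed

text \<open>Without the edge, \<open>desc v\<close> stays connected to \<open>v\<close> and every
  other vertex to \<open>r\<close>, while acyclicity keeps \<open>v\<close> apart from
  \<open>r\<close>. So these are exactly the two components.\<close>

lemma far_side_parent_edge:
  assumes sp: "spanning_tree V E F" and pF: "parent_edges \<subseteq> F" and v: "v \<in> V - {r}"
  shows "far_side V r F {v, par v} = desc v"
proof -
  let ?A = "adj (F - {{v, par v}})"
  let ?J = "joined V (F - {{v, par v}})"
  have symA: "(y, x) \<in> ?A\<^sup>*" if "(x, y) \<in> ?A\<^sup>*" for x y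
    using that sym_rtrancl[OF sym_adj] by (metis symD)
  have ne: "v \<noteq> par v" using rank_par[of v] v by auto
  have pV: "par v \<in> V" using par_in v by auto
  have pd: "par v \<notin> desc v"
    using up_rank[of "par v" v] rank_par[of v] v by (auto simp: desc_def)
  have "(v, par v) \<notin> ?A\<^sup>*"
    by (rule acyclic_edge_is_bridge)
      (use sp pF v ne in \<open>auto simp: spanning_tree_def parent_edges_def\<close>)
  moreover have "(par v, r) \<in> ?A\<^sup>*" using non_desc_root[OF _ v pF] pd pV by blast
  ultimately have cut: "(v, r) \<notin> ?A\<^sup>*" using symA by (meson rtrancl_trans)
  have down: "(u, v) \<in> ?A\<^sup>*" if "u \<in> desc v" for u
    using desc_below[OF that v pF] .
  have outer: "(u, r) \<in> ?A\<^sup>*" if "u \<in> V" "u \<notin> desc v" for u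
    using non_desc_root[OF _ v pF] that by blast
  have class_desc: "?J `` {u} = desc v" if "u \<in> desc v" for u
  proof -
    have uV: "u \<in> V" using that by (simp add: desc_def)
    have "w \<in> desc v" if w: "(u, w) \<in> ?A\<^sup>*" "w \<in> V" for w
    proof (rule ccontr)
      assume "w \<notin> desc v"
      then have "(w, r) \<in> ?A\<^sup>*" using outer w by blast
      with w(1) symA[OF down[OF \<open>u \<in> desc v\<close>]] cut show False by (meson rtrancl_trans)
    qed
    moreover have "(u, w) \<in> ?A\<^sup>*" if "w \<in> desc v" for w
      using down[OF \<open>u \<in> desc v\<close>] symA[OF down[OF that]] by (rule rtrancl_trans)
    moreover have "w \<in> V" if "w \<in> desc v" for w using that by (simp add: desc_def)
    ultimately show ?thesis using uV by (auto simp: joined_def)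
  qed
  have vd: "v \<in> desc v" using v by (simp add: desc_def)
  have rd: "r \<notin> desc v" using down cut symA by blast
  show ?thesis
    unfolding far_side_def
  proof (rule the_equality)
    have "?J `` {v} \<in> graph_components V (F - {{v, par v}})"
      unfolding graph_components_def using v by (intro quotientI) auto
    then show "desc v \<in> graph_components V (F - {{v, par v}}) \<and> r \<notin> desc v"
      using class_desc[OF vd] rd by simp
  next
    fix C assume C: "C \<in> graph_components V (F - {{v, par v}}) \<and> r \<notin> C"
    then obtain u where u: "u \<in> V" "C = ?J `` {u}"
      by (auto simp: graph_components_def elim: quotientE)
    have "u \<in> desc v"
    proof (rule ccontr)
      assume "u \<notin> desc v"
      then have "r \<in> C" using outer u root_in by (auto simp: joined_def)
      with C show False by blast
    qed
    then show "C = desc v" using class_desc u by simp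
  qed
qed

text \<open>On a cycle, both neighbours of a vertex of maximal rank would have to be its parent,
  although they are distinct.\<close>

lemma parent_edges_acyclic: "\<not> (\<exists>xs. is_graph_cycle parent_edges xs)"
proof
  assume "\<exists>xs. is_graph_cycle parent_edges xs"
  then obtain xs where len: "3 \<le> length xs" and dist: "distinct xs"
    and edge: "\<And>i. i < length xs \<Longrightarrow> {xs ! i, xs ! (Suc i mod length xs)} \<in> parent_edges"
    by (auto simp: is_graph_cycle_def)
  let ?l = "length xs"
  have par_of: "y = par x" if "{x, y} \<in> parent_edges" "rank y \<le> rank x" for x y
    using that rank_par by (fastforce simp: parent_edges_def doubleton_eq_iff)
  have "Max ((\<lambda>i. rank (xs ! i)) ` {..<?l}) \<in> (\<lambda>i. rank (xs ! i)) ` {..<?l}"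
    using len by (intro Max_in) (auto simp: lessThan_empty_iff)
  then obtain i where i: "i < ?l" and
    eq: "Max ((\<lambda>i. rank (xs ! i)) ` {..<?l}) = rank (xs ! i)" by auto
  have mx: "rank (xs ! k) \<le> rank (xs ! i)" if "k < ?l" for k
    using that by (subst eq[symmetric], intro Max_ge) auto
  \<comment> \<open>\<open>h\<close> and \<open>k\<close> are the cyclic predecessor and successor
    of \<open>i\<close>; they differ because the cycle has length at least three.\<close>
  define h where "h = (if i = 0 then ?l - 1 else i - 1)"
  define k where "k = Suc i mod ?l"
  have k: "k < ?l" unfolding k_def by (rule mod_less_divisor) (use len in linarith)
  have hk: "h < ?l" "k < ?l" "Suc h mod ?l = i" using i len k by (auto simp: h_def)
  have "h \<noteq> k"
    using i len by (cases "Suc i = ?l") (auto simp: h_def k_def)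
  have "xs ! k = par (xs ! i)"
    using edge[OF i] mx[OF hk(2)] par_of by (simp add: k_def)
  moreover have "xs ! h = par (xs ! i)"
    using edge[OF hk(1)] mx[OF hk(1)] par_of hk(3) by (simp add: insert_commute)
  ultimately show False
    using nth_eq_iff_index_eq[OF dist hk(1,2)] \<open>h \<noteq> k\<close> by simp
qed

lemma parent_edges_spanning_tree:
  assumes "parent_edges \<subseteq> E"
  shows "spanning_tree V E parent_edges"
proof -
  have "(u, r) \<in> (adj parent_edges)\<^sup>*" if "u \<in> V" for u
  proof -
    have "up \<subseteq> adj parent_edges"
      using rank_par by (fastforce simp: up_def adj_def parent_edges_def)
    then show ?thesis using up_root[OF that] rtrancl_mono by blast
  qed
  then have "(u, r) \<in> joined V parent_edges" if "u \<in> V" for u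
    using that root_in by (auto simp: joined_def)
  then have "graph_connected V parent_edges"
    using equiv_joined[of V parent_edges] root_in
    unfolding graph_connected_def equiv_def by (meson empty_iff symD transD)
  then show ?thesis using assms parent_edges_acyclic by (simp add: spanning_tree_def)
qed

text \<open>Distinct vertices have distinct parent edges, and further edges of \<open>F\<close>
  could only add non-negative terms.\<close>

lemma loss_ge_parent_edges:
  assumes sp: "spanning_tree V E F" and pF: "parent_edges \<subseteq> F" and "finite F"
  shows "(\<Sum>v\<in>V - {r}. (real (card (desc v)))\<^sup>2) \<le> ednr_loss V r (\<lambda>_. 1) (\<lambda>_. 1) F"
proof -
  let ?g = "\<lambda>e. (real (card (far_side V r F e)))\<^sup>2"
  have "(\<Sum>v\<in>V - {r}. (real (card (desc v)))\<^sup>2) = (\<Sum>v\<in>V - {r}. ?g {v, par v})"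
    using far_side_parent_edge[OF sp pF] by (intro sum.cong) auto
  also have "\<dots> = sum ?g parent_edges"
    unfolding parent_edges_def by (simp add: sum.reindex[OF parent_edge_inj])
  also have "\<dots> \<le> sum ?g F"
    using assms by (intro sum_mono2) auto
  finally show ?thesis by (simp add: ednr_loss_def)
qed

lemma loss_parent_edges:
  assumes "parent_edges \<subseteq> E"
  shows "ednr_loss V r (\<lambda>_. 1) (\<lambda>_. 1) parent_edges = (\<Sum>v\<in>V - {r}. (real (card (desc v)))\<^sup>2)"
proof -
  note sp = parent_edges_spanning_tree[OF assms]
  show ?thesis
    unfolding ednr_loss_def
    by (subst (2) parent_edges_def, subst sum.reindex[OF parent_edge_inj])
      (simp add: far_side_parent_edge[OF sp order_refl])
qed

text \<open>\<open>B\<close> acts as a potential: paying locally for a vertex and the potentials of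
  its children, it bounds whole subtrees. This reduces the analysis of the explicit tree to an
  inequality between neighbouring cells.\<close>

lemma card_desc_le:
  fixes B :: "'v \<Rightarrow> real"
  assumes B: "\<And>v. v \<in> V - {r} \<Longrightarrow> 1 + (\<Sum>w\<in>{w \<in> V - {r}. par w = v}. B w) \<le> B v"
  shows "v \<in> V - {r} \<Longrightarrow> real (card (desc v)) \<le> B v"
proof (induction "card (desc v)" arbitrary: v rule: less_induct)
  case less
  let ?C = "{w \<in> V - {r}. par w = v}"
  have eq: "desc v = insert v (\<Union>w\<in>?C. desc w)"
  proof -
    have "u = v \<or> (\<exists>w\<in>?C. (u, w) \<in> up\<^sup>*)" if "(u, v) \<in> up\<^sup>*" for u
      using that by (cases rule: rtranclE) (auto simp: up_def)
    moreover have "(u, v) \<in> up\<^sup>*" if "w \<in> ?C" "(u, w) \<in> up\<^sup>*" for u w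
      using that by (auto simp: up_def intro: rtrancl_into_rtrancl)
    ultimately show ?thesis using less.prems by (fastforce simp: desc_def)
  qed
  have IH: "real (card (desc w)) \<le> B w" if "w \<in> ?C" for w
  proof (rule less.hyps)
    have "v \<notin> desc w"
      using up_rank[of v w] rank_par[of w] that by (auto simp: desc_def)
    then have "desc w \<subset> desc v" using eq that by blast
    then show "card (desc w) < card (desc v)" by (rule psubset_card_mono[OF desc_finite])
  qed (use that in auto)
  have "card (desc v) \<le> Suc (card (\<Union>w\<in>?C. desc w))"
    unfolding eq by (rule card_insert_le_m1[THEN le_trans]) auto
  also have "card (\<Union>w\<in>?C. desc w) \<le> (\<Sum>w\<in>?C. card (desc w))"
    using finite_V by (intro card_UN_le) auto
  finally have "real (card (desc v)) \<le> real (Suc (\<Sum>w\<in>?C. card (desc w)))"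
    by (simp only: of_nat_le_iff Suc_le_mono)
  also have "\<dots> = 1 + (\<Sum>w\<in>?C. real (card (desc w)))" by simp
  also have "\<dots> \<le> 1 + (\<Sum>w\<in>?C. B w)" using IH by (intro add_left_mono sum_mono)
  also have "\<dots> \<le> B v" using B less.prems by blast
  finally show ?case .
qed

end

section \<open>The layered lower bound for arbitrary spanning trees\<close>

lemma cauchy_schwarz_card:
  fixes f :: "'a \<Rightarrow> real"
  assumes "finite A" "real (card A) \<le> u" "0 < u"
  shows "(sum f A)\<^sup>2 / u \<le> (\<Sum>x\<in>A. (f x)\<^sup>2)"
proof -
  have "(sum f A)\<^sup>2 \<le> (\<Sum>x\<in>A. (f x)\<^sup>2) * real (card A)"
    using sum_squared_le_sum_of_squares[of f A] by (simp add: mult.commute)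
  also have "\<dots> \<le> (\<Sum>x\<in>A. (f x)\<^sup>2) * u"
    using assms by (intro mult_left_mono sum_nonneg) auto
  finally show ?thesis using assms by (simp add: field_simps)
qed

text \<open>The rank is the distance from \<open>r\<close> in \<open>F\<close>; the parent is the
  last vertex before \<open>v\<close> on a shortest walk from the root.\<close>

lemma spanning_tree_parent_map:
  assumes fin: "finite V" and r: "r \<in> V" and EV: "\<Union>E \<subseteq> V" and sp: "spanning_tree V E F"
  obtains par rank where "parent_map V r par rank" "parent_map.parent_edges V r par \<subseteq> F"
proof -
  define rank where "rank v = (LEAST k. (r, v) \<in> adj F ^^ k)" for v
  have reach: "\<exists>k. (r, v) \<in> adj F ^^ k" if "v \<in> V" for v
    using sp r that by (auto simp: spanning_tree_def graph_connected_def joined_def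
        simp flip: rtrancl_power)
  have "\<exists>z. z \<in> V \<and> rank z < rank v \<and> {v, z} \<in> F" if v: "v \<in> V" "v \<noteq> r" for v
  proof -
    have "(r, v) \<in> adj F ^^ rank v"
      unfolding rank_def using reach[OF v(1)] by (rule LeastI_ex)
    with v(2) obtain k z where k: "rank v = Suc k" "(r, z) \<in> adj F ^^ k" "(z, v) \<in> adj F"
      by (cases "rank v") auto
    then have "{v, z} \<in> F" by (auto simp: adj_def insert_commute)
    moreover have "rank z \<le> k" unfolding rank_def using k(2) by (rule Least_le)
    moreover have "z \<in> V" using \<open>{v, z} \<in> F\<close> sp EV by (auto simp: spanning_tree_def)
    ultimately show ?thesis using k(1) by auto
  qed
  then obtain par where par: "\<And>v. v \<in> V \<Longrightarrow> v \<noteq> r \<Longrightarrow>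
      par v \<in> V \<and> rank (par v) < rank v \<and> {v, par v} \<in> F" by metis
  interpret parent_map V r par rank
    using fin r par by unfold_locales auto
  show ?thesis using that[of par rank] par parent_map_axioms by (auto simp: parent_edges_def)
qed

text \<open>\<open>I\<close> selects the layers to be counted; \<open>u\<close> and \<open>s\<close>
  are bounds standing in for the exact cardinalities. Contributions of different layers add up
  because the layers are disjoint.\<close>

lemma layered_loss_lower_bound:
  fixes dist :: "'v \<Rightarrow> nat" and u s :: "nat \<Rightarrow> real"
  assumes fin: "finite V" and r: "r \<in> V" and EV: "\<Union>E \<subseteq> V" "finite E"
    and sp: "spanning_tree V E F"
    and dist0: "dist r = 0"
    and dist_edge: "\<And>x y. {x, y} \<in> E \<Longrightarrow> dist x \<le> Suc (dist y)"
    and I: "finite I" "0 \<notin> I"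
    and u: "\<And>k. k \<in> I \<Longrightarrow> real (card {v \<in> V. dist v = k}) \<le> u k" "\<And>k. k \<in> I \<Longrightarrow> 0 < u k"
    and s: "\<And>k. k \<in> I \<Longrightarrow> s k \<le> real (card {v \<in> V. k \<le> dist v})" "\<And>k. k \<in> I \<Longrightarrow> 0 \<le> s k"
  shows "(\<Sum>k\<in>I. (s k)\<^sup>2 / u k) \<le> ednr_loss V r (\<lambda>_. 1) (\<lambda>_. 1) F"
proof -
  obtain par rank where pm: "parent_map V r par rank"
    and pF: "parent_map.parent_edges V r par \<subseteq> F"
    using spanning_tree_parent_map[OF fin r EV(1) sp] .
  interpret parent_map V r par rank by (rule pm)
  define g where "g v = (real (card (desc v)))\<^sup>2" for v
  define Lay where "Lay k = {v \<in> V. dist v = k}" for k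
  have FE: "F \<subseteq> E" using sp by (simp add: spanning_tree_def)
  \<comment> \<open>An ascent to the root lowers \<open>dist\<close> by at most one per edge, so it
    cannot jump over layer \<open>k\<close>.\<close>
  have hit: "\<exists>y\<in>Lay k. (v, y) \<in> up\<^sup>*" if "k \<noteq> 0" "v \<in> V" "k \<le> dist v" for k v
    using that(2,3)
  proof (induction "rank v" arbitrary: v rule: less_induct)
    case less
    show ?case
    proof (cases "dist v = k")
      case True
      then show ?thesis using less.prems by (auto simp: Lay_def)
    next
      case False
      have vr: "v \<noteq> r" using less.prems dist0 that(1) by auto
      then have "{v, par v} \<in> E" using pF FE less.prems by (auto simp: parent_edges_def)
      then have "k \<le> dist (par v)" using dist_edge[of v "par v"] False less.prems by simp
      then obtain y where "y \<in> Lay k" "(par v, y) \<in> up\<^sup>*"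
        using less.hyps[of "par v"] rank_par par_in vr less.prems by blast
      moreover have "(v, par v) \<in> up" using vr less.prems by (auto simp: up_def)
      ultimately show ?thesis by (meson converse_rtrancl_into_rtrancl)
    qed
  qed
  have fL: "finite (Lay k)" for k using fin by (simp add: Lay_def)
  have layer: "(s k)\<^sup>2 / u k \<le> sum g (Lay k)" if k: "k \<in> I" for k
  proof -
    have "{v \<in> V. k \<le> dist v} \<subseteq> (\<Union>y\<in>Lay k. desc y)"
      using hit[of k] k I by (fastforce simp: desc_def)
    then have "card {v \<in> V. k \<le> dist v} \<le> card (\<Union>y\<in>Lay k. desc y)"
      using fL desc_finite by (intro card_mono) auto
    also have "\<dots> \<le> (\<Sum>y\<in>Lay k. card (desc y))" by (rule card_UN_le[OF fL])
    finally have "s k \<le> (\<Sum>y\<in>Lay k. real (card (desc y)))"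
      using s(1)[OF k] by (simp flip: of_nat_sum)
    then have "(s k)\<^sup>2 / u k \<le> (\<Sum>y\<in>Lay k. real (card (desc y)))\<^sup>2 / u k"
      using s(2)[OF k] u(2)[OF k] by (intro divide_right_mono power_mono) auto
    also have "\<dots> \<le> sum g (Lay k)"
      unfolding g_def using u[OF k] fL by (intro cauchy_schwarz_card) (auto simp: Lay_def)
    finally show ?thesis .
  qed
  have "(\<Sum>k\<in>I. (s k)\<^sup>2 / u k) \<le> (\<Sum>k\<in>I. sum g (Lay k))" by (intro sum_mono layer)
  also have "\<dots> = sum g (\<Union>k\<in>I. Lay k)"
    using I fL by (intro sum.UNION_disjoint[symmetric]) (auto simp: Lay_def)
  also have "\<dots> \<le> sum g (V - {r})"
    using fin I dist0 by (intro sum_mono2) (auto simp: Lay_def g_def)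
  also have "\<dots> \<le> ednr_loss V r (\<lambda>_. 1) (\<lambda>_. 1) F"
    unfolding g_def using sp pF finite_subset[OF FE EV(2)] by (rule loss_ge_parent_edges)
  finally show ?thesis .
qed

section \<open>Loads of the dyadic tree\<close>

text \<open>
  Cells are measured from the root corner and the grid has \<open>n\<close> rows and \<open>m \<ge> n\<close> columns. A cell keeps its row
  if its parent is \<open>(i, j - 1)\<close>; otherwise the parent is \<open>(i - 1, j)\<close>. Inside the triangle
  \<open>i + j < K\<close> exactly one cell splits on each diagonal, in the order that refines the dyadic partition of
  the rows. Beyond it, the cell of row \<open>i\<close> on the diagonal \<open>i + j = K - 1\<close> feeds, through its column, the rows
  of the \<open>i\<close>-th block of \<open>L\<close> consecutive rows.
\<close>

definition keeps_row :: "nat \<Rightarrow> nat \<Rightarrow> nat \<Rightarrow> nat \<Rightarrow> bool" where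
  "keeps_row K L i j \<longleftrightarrow>
     (if i + j < K then i + 2 * 2 ^ floor_log (i + j) \<le> 2 * (i + j) else K \<le> i div L + j)"

definition corner_parent :: "nat \<Rightarrow> nat \<Rightarrow> nat \<times> nat \<Rightarrow> nat \<times> nat" where
  "corner_parent K L = (\<lambda>(i, j). if keeps_row K L i j then (i, j - 1) else (i - 1, j))"

text \<open>The fraction of the demand behind the diagonal of \<open>k\<close> cells that is carried by its cell in row \<open>i\<close>.\<close>

definition share :: "nat \<Rightarrow> nat \<Rightarrow> real" where
  "share i k = (if i + 2 * 2 ^ floor_log k < 2 * k then 1 / (2 * 2 ^ floor_log k)
                else 1 / 2 ^ floor_log k)"

section \<open>Shares on the diagonals of the triangle\<close>

lemma floor_log_Suc_cases:
  assumes "0 < k"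
  obtains "Suc k < 2 * 2 ^ floor_log k" "floor_log (Suc k) = floor_log k"
  | "Suc k = 2 * 2 ^ floor_log k" "floor_log (Suc k) = Suc (floor_log k)"
proof (cases "Suc k < 2 * 2 ^ floor_log k")
  case True
  have "floor_log (Suc k) = floor_log k"
    by (rule floor_log_eqI) (use True floor_log_exp2_le[of k] assms in auto)
  with True show ?thesis by (rule that(1))
next
  case False
  then have eq: "Suc k = 2 * 2 ^ floor_log k" using floor_log_exp2_gt[of k] by linarith
  have "floor_log (Suc k) = Suc (floor_log k)"
    by (rule floor_log_eqI) (use eq in auto)
  with eq show ?thesis by (rule that(2))
qed

lemma share_pos: "0 < share i k"
  by (simp add: share_def)

lemma share_ge: "0 < k \<Longrightarrow> 1 \<le> share i k * (2 * real k)"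
proof -
  assume k: "0 < k"
  have "real (2 ^ floor_log k) \<le> real k"
    using floor_log_exp2_le[of k] k by (simp only: of_nat_le_iff)
  then have "1 \<le> 1 / (2 * 2 ^ floor_log k) * (2 * real k)" by (simp add: field_simps)
  also have "\<dots> \<le> share i k * (2 * real k)"
    by (intro mult_right_mono) (auto simp: share_def field_simps)
  finally show ?thesis .
qed

text \<open>With \<open>k = p + b\<close>, \<open>p\<close> the largest power of two not exceeding
  \<open>k\<close>, only row \<open>2 * b\<close> has a child both in its own row and in the next
  one, and its share \<open>1 / p\<close> is halved. Earlier rows pass their share on in the same
  row, later rows to the next row. If \<open>k + 1\<close> is a power of two, row
  \<open>2 * b\<close> is the last one and holds the only large share left.\<close>

lemma share_split:
  assumes "i < k"
  shows "(if i + 2 * 2 ^ floor_log k \<le> 2 * k then share i (Suc k) else 0) +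
         (if \<not> Suc i + 2 * 2 ^ floor_log k \<le> 2 * k then share (Suc i) (Suc k) else 0) = share i k"
proof -
  have k: "0 < k" using assms by simp
  show ?thesis
    using k
  proof (cases rule: floor_log_Suc_cases)
    case 1
    then show ?thesis by (auto simp: share_def field_simps)
  next
    case 2
    then show ?thesis using assms by (auto simp: share_def field_simps)
  qed
qed

text \<open>With \<open>k = p + b\<close>, \<open>p\<close> the largest power of two not exceeding \<open>k\<close>, the left side is
  \<open>(p - b / 2) / p\<^sup>2\<close>, and \<open>9 / 8 - (p + b) (p - b / 2) / p\<^sup>2 = (p - 2 b)\<^sup>2 / (8 p\<^sup>2)\<close>.\<close>

lemma sum_share_squares:
  assumes "0 < k"
  shows "(\<Sum>i<k. (share i k)\<^sup>2) \<le> 9 / (8 * real k)"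
proof -
  define p where "p = (2::nat) ^ floor_log k"
  define b where "b = k - p"
  have p: "p \<le> k" "k < 2 * p" "0 < p"
    using floor_log_exp2_le[of k] floor_log_exp2_gt[of k] assms by (auto simp: p_def)
  have k: "k = p + b" "b < p" using p by (auto simp: b_def)
  have rp: "(2::real) ^ floor_log k = real p" by (simp add: p_def)
  have sh: "share i k = (if i < 2 * b then 1 / (2 * real p) else 1 / real p)" for i
    unfolding share_def rp p_def[symmetric] using k by auto
  have "{..<k} = {..<2 * b} \<union> {2 * b..<k}" using k by auto
  then have "(\<Sum>i<k. (share i k)\<^sup>2) = (\<Sum>i<2 * b. (share i k)\<^sup>2) + (\<Sum>i=2 * b..<k. (share i k)\<^sup>2)"
    by (simp add: sum.union_disjoint ivl_disj_int)
  also have "(\<Sum>i<2 * b. (share i k)\<^sup>2) = real (2 * b) * (1 / (2 * real p))\<^sup>2"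
    by (simp add: sh)
  also have "(\<Sum>i=2 * b..<k. (share i k)\<^sup>2) = real (k - 2 * b) * (1 / real p)\<^sup>2"
    by (simp add: sh)
  also have "real (k - 2 * b) = real p - real b" using k by simp
  finally have eq: "(\<Sum>i<k. (share i k)\<^sup>2) = (real p - real b / 2) / (real p)\<^sup>2"
    using p(3) by (simp add: power2_eq_square diff_divide_distrib)
  have "(real p - real b / 2) * (8 * (real p + real b)) \<le> 9 * (real p)\<^sup>2"
    using zero_le_power2[of "real p - 2 * real b"] by (simp add: power2_eq_square algebra_simps)
  then show ?thesis
    unfolding eq using p(3) k(1) by (simp add: frac_le_eq divide_simps mult.commute mult.left_commute)
qed

section \<open>The local load inequality and the total squared load\<close>

text \<open>\<open>K_pow\<close> makes \<open>K\<close> a power of two, so that all shares on the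
  last diagonal of the triangle equal \<open>1 / K\<close>; by \<open>n_le\<close> the
  \<open>K\<close> blocks of \<open>L\<close> rows cover the grid.\<close>

locale corner_grid =
  fixes n m K L :: nat
  assumes K_pow: "2 ^ floor_log K = K" and L_pos: "0 < L"
    and n_le: "n \<le> L * K" and K_le: "K \<le> n" and n_le_m: "n \<le> m"
begin

abbreviation cells :: "(nat \<times> nat) set" where "cells \<equiv> {..<n} \<times> {..<m}"

lemma K_pos: "0 < K"
  using K_pow by (metis zero_less_numeral zero_less_power)

text \<open>Bounds what hangs below one of the \<open>K\<close> branches: at most \<open>n\<close>
  cells of a column and \<open>L\<close> rows of at most \<open>m\<close> cells each.\<close>

definition branch :: real where
  "branch = real n + real m * real L"

text \<open>Column \<open>j\<close> feeds the rows from \<open>L * (K - 1 - j)\<close> to below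
  \<open>L * (K - j)\<close>. Counted are the column cells from row \<open>i\<close> on, and
  \<open>m\<close> cells for every row of that block from row \<open>i\<close> on.\<close>

definition column_load :: "nat \<Rightarrow> nat \<Rightarrow> real" where
  "column_load i j = real n - real i + real m * (real (L * (K - j)) - real (max i (L * (K - 1 - j))))"

text \<open>
  The subtrahend in the triangular case is \<open>\<Sum>k'<k. 2 k'\<close> for \<open>k = i + j + 1\<close>: since \<open>share i k \<ge> 1 / (2 k)\<close>,
  the demand of the cell itself is paid for by the term \<open>2 k\<close> that its children lack.
\<close>

definition load :: "nat \<Rightarrow> nat \<Rightarrow> real" where
  "load i j =
     (if i + j < K then share i (Suc (i + j)) *
        (branch * real K + real K * (real K + 1) - real (i + j) * real (Suc (i + j)))
      else if K \<le> i div L + j then real m - real j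
      else column_load i j)"

text \<open>With truncated subtraction, a cell of column zero that keeps its row would be its own
  parent. Inside the triangle \<open>i < 2 * 2 ^ floor_log i\<close> excludes this, outside it
  \<open>i div L < K\<close> does.\<close>

lemma keeps_row_pos:
  assumes "i < n" "keeps_row K L i j" "0 < i + j"
  shows "0 < j"
proof (rule ccontr)
  assume "\<not> 0 < j"
  then have j: "j = 0" by simp
  have "i div L < K" using assms(1) n_le L_pos by (simp add: div_less_iff_less_mult mult.commute)
  with assms j floor_log_exp2_gt[of i] show False
    by (auto simp: keeps_row_def split: if_splits)
qed

lemma not_keeps_row_pos:
  assumes "\<not> keeps_row K L i j" "0 < i + j"
  shows "0 < i"
proof (rule ccontr)
  assume "\<not> 0 < i"
  then have "i = 0" by simp
  with assms floor_log_exp2_le[of j] show False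
    by (auto simp: keeps_row_def split: if_splits)
qed

lemma corner_parent_decreasing:
  assumes "v \<in> cells" "v \<noteq> (0, 0)"
  shows "fst (corner_parent K L v) + snd (corner_parent K L v) < fst v + snd v"
proof -
  obtain i j where v: "v = (i, j)" "i < n" "j < m" "0 < i + j" using assms by (cases v) auto
  from v keeps_row_pos[of i j] not_keeps_row_pos[of i j]
  show ?thesis
    by (auto simp: corner_parent_def)
qed

lemma column_region_iff: "i div L + j < K \<longleftrightarrow> i < L * (K - j)"
  using div_less_iff_less_mult[OF L_pos, of i "K - j"] by (auto simp: mult.commute)

lemma column_load_bounds:
  assumes "i < n" "i div L + j < K"
  shows "1 \<le> column_load i j" "column_load i j \<le> branch"
proof -
  have i: "i < L * (K - j)" using assms column_region_iff by simp
  have j: "K - j = Suc (K - 1 - j)" using assms by simp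
  have "max i (L * (K - 1 - j)) \<le> L * (K - j)" using i j by simp
  then have "0 \<le> real m * (real (L * (K - j)) - real (max i (L * (K - 1 - j))))"
    by (intro mult_nonneg_nonneg) (simp_all only: of_nat_le_iff diff_ge_0_iff_ge of_nat_0_le_iff)
  then show "1 \<le> column_load i j" using assms(1) unfolding column_load_def by linarith
  have "L * (K - j) = L + L * (K - 1 - j)" using j by simp
  then have "real (L * (K - j)) = real L + real (L * (K - 1 - j))" by (simp only: of_nat_add)
  moreover have "real (L * (K - 1 - j)) \<le> real (max i (L * (K - 1 - j)))"
    by (simp only: of_nat_le_iff)
  ultimately have "real (L * (K - j)) - real (max i (L * (K - 1 - j))) \<le> real L" by linarith
  then have "real m * (real (L * (K - j)) - real (max i (L * (K - 1 - j)))) \<le> real m * real L"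
    by (rule mult_left_mono) simp
  then show "column_load i j \<le> branch" by (simp add: column_load_def branch_def)
qed

text \<open>Before its block, a column gives up only the cell itself. Inside the block each step
  also frees the amount \<open>m\<close>, which pays for the row branching off; at the last row of
  the block or of the grid, one such amount is still left.\<close>

lemma column_load_step:
  assumes "i < n" "i div L + j < K"
  shows "1 + (if K \<le> i div L + Suc j then real m - real (Suc j) else 0) +
           (if Suc i < n \<and> Suc i div L + j < K then column_load (Suc i) j else 0) \<le> column_load i j"
proof -
  \<comment> \<open>\<open>M\<close> is the index of the block fed by column
    \<open>j\<close>.\<close>
  define M where "M = K - 1 - j"
  have KM: "K - j = Suc M" "K = Suc M + j" using assms by (auto simp: M_def)
  have i: "i < L * Suc M" using assms(2) column_region_iff[of i j] KM(1) by (simp only:)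
  have c1: "K \<le> i div L + Suc j \<longleftrightarrow> L * M \<le> i"
    using column_region_iff[of i "Suc j"] KM by (auto simp: not_less[symmetric])
  have c2: "Suc i div L + j < K \<longleftrightarrow> Suc i < L * Suc M"
    using column_region_iff[of "Suc i" j] KM by simp
  have ci: "column_load i' j = real n - real i' + real m * (real (L * Suc M) - real (max i' (L * M)))" for i'
    by (simp add: column_load_def KM(1) M_def)
  show ?thesis
  proof (cases "L * M \<le> i")
    case True
    show ?thesis
    proof (cases "Suc i < n \<and> Suc i < L * Suc M")
      case T: True
      have "column_load i j - column_load (Suc i) j = 1 + real m"
        unfolding ci using True by (simp add: algebra_simps)
      then show ?thesis using True T c1 c2 by simp
    next
      case False
      have "real (Suc i) \<le> real (L * Suc M)" using i by (simp only: of_nat_le_iff Suc_le_eq)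
      then have "1 \<le> real (L * Suc M) - real (max i (L * M))" using True by simp
      then have "real m * 1 \<le> real m * (real (L * Suc M) - real (max i (L * M)))"
        by (rule mult_left_mono) simp
      then have "1 + real m \<le> column_load i j" unfolding ci using assms(1) by linarith
      then show ?thesis using False c1 c2 by auto
    qed
  next
    case False
    then have "column_load i j - column_load (Suc i) j = 1"
      unfolding ci by (simp add: algebra_simps max_def)
    then show ?thesis using False c1 column_load_bounds(1)[OF assms] by auto
  qed
qed

lemma load_step:
  assumes "i < n" "j < m"
  shows "1 + (if Suc j < m \<and> keeps_row K L i (Suc j) then load i (Suc j) else 0) +
           (if Suc i < n \<and> \<not> keeps_row K L (Suc i) j then load (Suc i) j else 0) \<le> load i j"
    (is "1 + ?A + ?B \<le> _")
proof -
  consider "Suc (i + j) < K" | "Suc (i + j) = K" | "K \<le> i + j" "K \<le> i div L + j"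
    | "K \<le> i + j" "i div L + j < K" by linarith
  then show ?thesis
  proof cases
    case 1
    define k where "k = Suc (i + j)"
    define Y where "Y = branch * real K + real K * (real K + 1)"
    let ?a = "if i + 2 * 2 ^ floor_log k \<le> 2 * k then share i (Suc k) else 0"
    let ?b = "if \<not> Suc i + 2 * 2 ^ floor_log k \<le> 2 * k then share (Suc i) (Suc k) else 0"
    have bnd: "Suc j < m" "Suc i < n" using 1 K_le n_le_m by auto
    have A: "?A = ?a * (Y - real k * real (Suc k))"
      using bnd 1 by (simp add: keeps_row_def load_def k_def Y_def)
    have B: "?B = ?b * (Y - real k * real (Suc k))"
      using bnd 1 by (simp add: keeps_row_def load_def k_def Y_def)
    have "?A + ?B = share i k * (Y - real k * real (Suc k))"
      unfolding A B distrib_right[symmetric] by (subst share_split) (auto simp: k_def)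
    moreover have "load i j = share i k * (Y - (real k - 1) * real k)"
      using 1 by (simp add: load_def k_def Y_def)
    \<comment> \<open>The load exceeds the loads of the children by exactly \<open>2 k\<close>
      shares, as \<open>k (k + 1) - (k - 1) k = 2 k\<close>.\<close>
    moreover have "1 \<le> share i k * (2 * real k)" by (rule share_ge) (simp add: k_def)
    ultimately show ?thesis by (simp add: algebra_simps)
  next
    case 2
    \<comment> \<open>On the last diagonal the children already satisfy the bounds of the column
      region, and the load of the cell evaluates to \<open>branch + 2\<close>.\<close>
    have col: "i div L + j < K" using 2 div_le_dividend[of i L] by linarith
    have "(2::real) ^ floor_log K = real K"
      using arg_cong[OF K_pow, of real] by simp
    then have "share i K = 1 / real K" using K_pow by (simp add: share_def)
    moreover have ij: "real (i + j) = real K - 1" using arg_cong[OF 2, of real] by simp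
    ultimately have "load i j = 1 / real K * (branch * real K + real K * (real K + 1) - (real K - 1) * real K)"
      using 2 by (simp add: load_def ij)
    also have "\<dots> = branch + 2" using K_pos by (simp add: field_simps)
    finally have load: "load i j = branch + 2" .
    have A: "?A \<le> (if K \<le> i div L + Suc j then real m - real (Suc j) else 0)"
      using 2 assms by (auto simp: keeps_row_def load_def)
    have B: "?B \<le> (if Suc i < n \<and> Suc i div L + j < K then column_load (Suc i) j else 0)"
      using 2 assms by (auto simp: keeps_row_def load_def)
    from A B column_load_step[OF assms(1) col] column_load_bounds(2)[OF assms(1) col] load
    show ?thesis by linarith
  next
    case 3
    have "K \<le> Suc i div L + j" using 3(2) div_le_mono[of i "Suc i" L] by linarith
    then show ?thesis using 3 assms by (auto simp: keeps_row_def load_def)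
  next
    case 4
    have A: "?A \<le> (if K \<le> i div L + Suc j then real m - real (Suc j) else 0)"
      using 4 assms by (auto simp: keeps_row_def load_def)
    have B: "?B \<le> (if Suc i < n \<and> Suc i div L + j < K then column_load (Suc i) j else 0)"
      using 4 assms by (auto simp: keeps_row_def load_def)
    have "load i j = column_load i j" using 4 by (simp add: load_def)
    with A B column_load_step[OF assms(1) 4(2)] show ?thesis by linarith
  qed
qed

lemma load_children:
  assumes "v \<in> cells"
  shows "1 + (\<Sum>w\<in>{w \<in> cells - {(0, 0)}. corner_parent K L w = v}. load (fst w) (snd w))
           \<le> load (fst v) (snd v)"
proof -
  obtain i j where v: "v = (i, j)" "i < n" "j < m" using assms by auto
  let ?S = "if Suc j < m \<and> keeps_row K L i (Suc j) then {(i, Suc j)} else {}"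
  let ?T = "if Suc i < n \<and> \<not> keeps_row K L (Suc i) j then {(Suc i, j)} else {}"
  have "{w \<in> cells - {(0, 0)}. corner_parent K L w = v} = ?S \<union> ?T"
  proof (intro set_eqI iffI)
    fix w assume w: "w \<in> {w \<in> cells - {(0, 0)}. corner_parent K L w = v}"
    then show "w \<in> ?S \<union> ?T"
      using v keeps_row_pos[of "fst w" "snd w"] not_keeps_row_pos[of "fst w" "snd w"]
      by (cases w) (auto simp: corner_parent_def split: if_splits)
  qed (use v in \<open>auto simp: corner_parent_def split: if_splits\<close>)
  then have "(\<Sum>w\<in>{w \<in> cells - {(0, 0)}. corner_parent K L w = v}. load (fst w) (snd w)) =
      (\<Sum>w\<in>?S. load (fst w) (snd w)) + (\<Sum>w\<in>?T. load (fst w) (snd w))"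
    by (simp add: sum.union_disjoint)
  then show ?thesis using load_step[OF v(2,3)] v(1) by (auto split: if_splits)
qed

text \<open>This is \<open>load 0 0\<close>, the amount distributed by the shares.\<close>

definition root_load :: real where
  "root_load = branch * real K + real K * (real K + 1)"

text \<open>The summands come from the triangle \<open>T\<close>, the columns \<open>C\<close> and
  the rows \<open>R\<close>: \<open>T\<close> is summed diagonal by diagonal, \<open>C\<close> has
  at most \<open>n * K\<close> cells of load at most \<open>branch\<close>, and a cell of
  \<open>R\<close> in column \<open>j\<close> has load \<open>m - j\<close>.\<close>

lemma sum_load_squares:
  "(\<Sum>v\<in>cells - {(0, 0)}. (load (fst v) (snd v))\<^sup>2)
     \<le> 9 / 8 * root_load\<^sup>2 * (\<Sum>k=2..K. 1 / real k) + real n * real K * branch\<^sup>2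
        + real n * (\<Sum>t=1..m. (real t)\<^sup>2)"
proof -
  let ?f = "\<lambda>v. (load (fst v) (snd v))\<^sup>2"
  define T where "T = {v \<in> cells - {(0, 0)}. fst v + snd v < K}"
  define C where "C = {v \<in> cells. K \<le> fst v + snd v \<and> fst v div L + snd v < K}"
  define R where "R = {v \<in> cells. K \<le> fst v div L + snd v}"
  have R_outer: "K \<le> fst v + snd v" if "v \<in> R" for v
  proof -
    have "K \<le> fst v div L + snd v" using that by (simp add: R_def)
    with div_le_dividend[of "fst v" L] show ?thesis by linarith
  qed
  have "cells - {(0, 0)} = T \<union> C \<union> R"
  proof (intro set_eqI iffI)
    fix v assume "v \<in> T \<union> C \<union> R"
    then show "v \<in> cells - {(0, 0)}"
      using K_pos R_outer[of v] by (auto simp: T_def C_def R_def)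
  qed (auto simp: T_def C_def R_def)
  moreover have "T \<inter> C = {}" by (auto simp: T_def C_def)
  moreover have "v \<notin> R" if "v \<in> T \<union> C" for v
    using that R_outer[of v] by (auto simp: T_def C_def R_def)
  then have "(T \<union> C) \<inter> R = {}" by blast
  moreover have fin: "finite T" "finite C" "finite R" by (auto simp: T_def C_def R_def)
  ultimately have split: "sum ?f (cells - {(0, 0)}) = sum ?f T + sum ?f C + sum ?f R"
    by (simp add: sum.union_disjoint)
  have "sum ?f C \<le> (\<Sum>v\<in>C. branch\<^sup>2)"
  proof (rule sum_mono)
    fix v assume "v \<in> C"
    then have v: "fst v < n" "fst v div L + snd v < K" and
      "load (fst v) (snd v) = column_load (fst v) (snd v)"
      by (auto simp: C_def load_def)
    with column_load_bounds[OF v] show "?f v \<le> branch\<^sup>2" by (auto intro: power_mono)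
  qed
  also have "\<dots> = real (card C) * branch\<^sup>2" by simp
  also have "\<dots> \<le> real (n * K) * branch\<^sup>2"
  proof (rule mult_right_mono)
    have "C \<subseteq> {..<n} \<times> {..<K}" by (auto simp: C_def)
    then have "card C \<le> card ({..<n} \<times> {..<K})" by (intro card_mono) auto
    then show "real (card C) \<le> real (n * K)"
      by (simp only: card_cartesian_product card_lessThan of_nat_le_iff)
  qed simp
  finally have sumC: "sum ?f C \<le> real n * real K * branch\<^sup>2" by simp
  have "sum ?f R = (\<Sum>v\<in>R. (real m - real (snd v))\<^sup>2)"
  proof (rule sum.cong)
    fix v assume "v \<in> R"
    then show "?f v = (real m - real (snd v))\<^sup>2"
      using R_outer[of v] by (simp add: R_def load_def)
  qed simp
  also have "\<dots> \<le> (\<Sum>v\<in>cells. (real m - real (snd v))\<^sup>2)"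
    by (rule sum_mono2) (auto simp: R_def)
  also have "\<dots> = (\<Sum>i<n. \<Sum>j<m. (real m - real j)\<^sup>2)"
    unfolding sum.cartesian_product by (simp add: case_prod_beta)
  also have "(\<Sum>j<m. (real m - real j)\<^sup>2) = (\<Sum>t=1..m. (real t)\<^sup>2)"
    by (rule sum.reindex_bij_witness[of _ "\<lambda>t. m - t" "\<lambda>j. m - j"]) (auto simp: of_nat_diff)
  finally have sumR: "sum ?f R \<le> real n * (\<Sum>t=1..m. (real t)\<^sup>2)" by simp
  \<comment> \<open>A triangle cell is indexed by its row \<open>i\<close> and the number
    \<open>k\<close> of cells on its diagonal; the root, the only cell with \<open>k = 1\<close>, is
    left out.\<close>
  have "sum ?f T = (\<Sum>(k, i)\<in>Sigma {2..K} (\<lambda>k. {..<k}). ?f (i, k - 1 - i))"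
    by (rule sum.reindex_bij_witness[of _ "\<lambda>(k, i). (i, k - 1 - i)" "\<lambda>v. (Suc (fst v + snd v), fst v)"])
      (use K_le n_le_m in \<open>auto simp: T_def\<close>)
  also have "\<dots> = (\<Sum>k=2..K. \<Sum>i<k. ?f (i, k - 1 - i))"
    by (rule sum.Sigma[symmetric]) auto
  also have "\<dots> \<le> (\<Sum>k=2..K. 9 / 8 * root_load\<^sup>2 * (1 / real k))"
  proof (rule sum_mono)
    fix k assume k: "k \<in> {2..K}"
    have "?f (i, k - 1 - i) \<le> (share i k)\<^sup>2 * root_load\<^sup>2" if i: "i < k" for i
    proof -
      have eq: "i + (k - 1 - i) = k - 1" using i by simp
      define z where "z = root_load - real (k - 1) * real k"
      have "real (k - 1) * real k \<le> real K * (real K + 1)"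
        using k by (intro mult_mono) auto
      moreover have "0 \<le> branch * real K" by (simp add: branch_def)
      ultimately have "0 \<le> z" "z \<le> root_load" by (auto simp: z_def root_load_def)
      moreover have "load i (k - 1 - i) = share i k * z"
        using k by (simp only: load_def eq) (auto simp: z_def root_load_def)
      ultimately show ?thesis
        using share_pos[of i k] by (auto simp: power_mult_distrib intro!: mult_left_mono power_mono)
    qed
    then have "(\<Sum>i<k. ?f (i, k - 1 - i)) \<le> (\<Sum>i<k. (share i k)\<^sup>2 * root_load\<^sup>2)"
      by (intro sum_mono) auto
    also have "\<dots> = (\<Sum>i<k. (share i k)\<^sup>2) * root_load\<^sup>2" by (simp add: sum_distrib_right)
    also have "\<dots> \<le> 9 / (8 * real k) * root_load\<^sup>2"
      using k by (intro mult_right_mono sum_share_squares) auto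
    finally show "(\<Sum>i<k. ?f (i, k - 1 - i)) \<le> 9 / 8 * root_load\<^sup>2 * (1 / real k)"
      by (simp add: mult.commute)
  qed
  also have "\<dots> = 9 / 8 * root_load\<^sup>2 * (\<Sum>k=2..K. 1 / real k)" by (simp only: sum_distrib_left)
  finally have sumT: "sum ?f T \<le> 9 / 8 * root_load\<^sup>2 * (\<Sum>k=2..K. 1 / real k)" .
  show ?thesis unfolding split using sumT sumC sumR by linarith
qed

end

section \<open>Grids with an arbitrary root corner\<close>

definition gap :: "nat \<Rightarrow> nat \<Rightarrow> nat" where
  "gap a x = (x - a) + (a - x)"

definition toward :: "nat \<Rightarrow> nat \<Rightarrow> nat" where
  "toward a x = (if x < a then x + 1 else x - 1)"

definition from_corner :: "bool \<Rightarrow> nat \<times> nat \<Rightarrow> nat \<times> nat \<Rightarrow> nat \<times> nat" where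
  "from_corner sw r v =
     (if sw then (gap (snd r) (snd v), gap (fst r) (fst v))
      else (gap (fst r) (fst v), gap (snd r) (snd v)))"

text \<open>Keeping the row in corner coordinates moves the second grid coordinate, or the first one
  if the axes are swapped; hence the comparison with \<open>sw\<close>.\<close>

definition grid_parent :: "bool \<Rightarrow> nat \<Rightarrow> nat \<Rightarrow> nat \<times> nat \<Rightarrow> nat \<times> nat \<Rightarrow> nat \<times> nat" where
  "grid_parent sw K L r v =
     (if keeps_row K L (fst (from_corner sw r v)) (snd (from_corner sw r v)) = sw
      then (toward (fst r) (fst v), snd v) else (fst v, toward (snd r) (snd v)))"

lemma gap_toward: "0 < gap a x \<Longrightarrow> gap a (toward a x) = gap a x - 1"
  by (auto simp: gap_def toward_def)

lemma gap_0_iff [simp]: "gap a x = 0 \<longleftrightarrow> x = a"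
  by (auto simp: gap_def)

lemma toward_adjacent: "0 < gap a x \<Longrightarrow> \<bar>int x - int (toward a x)\<bar> = 1"
  by (auto simp: gap_def toward_def)

lemma toward_less: "a < n \<Longrightarrow> x < n \<Longrightarrow> toward a x < n"
  by (auto simp: toward_def)

text \<open>For an end point \<open>a\<close> this is the identity or the reversal, each its own
  inverse.\<close>

lemma gap_bij:
  assumes "a = 0 \<or> a = n - 1" "0 < n"
  shows "bij_betw (gap a) {..<n} {..<n}"
proof (rule bij_betw_byWitness[where f' = "gap a"])
qed (use assms in \<open>auto simp: gap_def\<close>)

lemma grid_edges_finite: "finite (grid_edges n m)"
  and grid_edges_verts: "\<Union>(grid_edges n m) \<subseteq> grid_verts n m"
proof -
  show "\<Union>(grid_edges n m) \<subseteq> grid_verts n m" by (auto simp: grid_edges_def)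
  then have "grid_edges n m \<subseteq> Pow (grid_verts n m)" by blast
  then show "finite (grid_edges n m)"
    by (rule finite_subset) (simp add: grid_verts_def)
qed

lemma grid_edges_gap:
  assumes "{x, y} \<in> grid_edges n m"
  shows "gap a (fst x) + gap b (snd x) \<le> Suc (gap a (fst y) + gap b (snd y))"
proof -
  from assms obtain i j i' j' where e: "{x, y} = {(i, j), (i', j')}"
    and d: "\<bar>int i - int i'\<bar> + \<bar>int j - int j'\<bar> = 1"
    by (auto simp: grid_edges_def)
  have g: "int (gap c x) \<le> int (gap c x') + \<bar>int x - int x'\<bar>" for c x x'
    by (auto simp: gap_def)
  from d g[of a i i'] g[of a i' i] g[of b j j'] g[of b j' j]
  have "gap a i + gap b j \<le> Suc (gap a i' + gap b j')"
    "gap a i' + gap b j' \<le> Suc (gap a i + gap b j)"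
    by linarith+
  with e show ?thesis by (auto simp: doubleton_eq_iff)
qed

section \<open>Layer sizes and lower bounds on the grid\<close>

locale rooted_grid =
  fixes n0 m0 :: nat and r :: "nat \<times> nat"
  assumes n0_pos: "1 \<le> n0" and m0_pos: "1 \<le> m0" and corner: "r \<in> grid_corners n0 m0"
begin

definition n :: nat where "n = min n0 m0"
definition m :: nat where "m = max n0 m0"
definition sw :: bool where "sw \<longleftrightarrow> m0 < n0"

abbreviation V :: "(nat \<times> nat) set" where "V \<equiv> grid_verts n0 m0"
abbreviation E :: "(nat \<times> nat) set set" where "E \<equiv> grid_edges n0 m0"
abbreviation loss :: "(nat \<times> nat) set set \<Rightarrow> real" where "loss \<equiv> ednr_loss V r (\<lambda>_. 1) (\<lambda>_. 1)"
abbreviation depth :: "nat \<times> nat \<Rightarrow> nat" where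
  "depth v \<equiv> gap (fst r) (fst v) + gap (snd r) (snd v)"

lemma nm: "1 \<le> n" "n \<le> m"
  using n0_pos m0_pos by (auto simp: n_def m_def)

lemma root_in: "r \<in> V"
  using corner n0_pos m0_pos by (auto simp: grid_corners_def grid_verts_def)

lemma finite_V: "finite V"
  by (simp add: grid_verts_def)

lemma from_corner_0_iff [simp]: "from_corner sw r v = (0, 0) \<longleftrightarrow> v = r"
  by (auto simp: from_corner_def prod_eq_iff)

lemma depth_from_corner: "depth v = fst (from_corner sw r v) + snd (from_corner sw r v)"
  by (simp add: from_corner_def)

lemma from_corner_bij: "bij_betw (from_corner sw r) V ({..<n} \<times> {..<m})"
proof -
  have 1: "bij_betw (gap (fst r)) {..<n0} {..<n0}"
    using corner n0_pos by (intro gap_bij) (auto simp: grid_corners_def)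
  have 2: "bij_betw (gap (snd r)) {..<m0} {..<m0}"
    using corner m0_pos by (intro gap_bij) (auto simp: grid_corners_def)
  have mp: "bij_betw (map_prod (gap (fst r)) (gap (snd r))) V ({..<n0} \<times> {..<m0})"
    unfolding grid_verts_def using 1 2 by (rule bij_betw_map_prod)
  show ?thesis
  proof (cases sw)
    case True
    have "bij_betw prod.swap ({..<n0} \<times> {..<m0}) ({..<m0} \<times> {..<n0})"
      by (rule bij_betw_byWitness[where f' = prod.swap]) auto
    with mp have "bij_betw (prod.swap \<circ> map_prod (gap (fst r)) (gap (snd r))) V ({..<m0} \<times> {..<n0})"
      by (rule bij_betw_trans)
    also have "prod.swap \<circ> map_prod (gap (fst r)) (gap (snd r)) = from_corner sw r"
      using True by (auto simp: from_corner_def fun_eq_iff)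
    finally show ?thesis using True by (simp add: sw_def n_def m_def)
  next
    case False
    have "map_prod (gap (fst r)) (gap (snd r)) = from_corner sw r"
      using False by (auto simp: from_corner_def fun_eq_iff)
    with mp False show ?thesis by (simp add: sw_def n_def m_def)
  qed
qed

lemma card_V: "card V = n * m"
  using bij_betw_same_card[OF from_corner_bij] by (simp add: card_cartesian_product)

lemma card_filter_from_corner:
  "card {v \<in> V. P (depth v)} = card {w \<in> {..<n} \<times> {..<m}. P (fst w + snd w)}"
proof (rule bij_betw_same_card[of "from_corner sw r"])
  have "bij_betw (from_corner sw r) {v \<in> V. P (depth v)} (from_corner sw r ` {v \<in> V. P (depth v)})"
    using from_corner_bij by (auto simp: bij_betw_def intro: inj_on_subset)
  also have "from_corner sw r ` {v \<in> V. P (depth v)} = {w \<in> {..<n} \<times> {..<m}. P (fst w + snd w)}"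
    unfolding depth_from_corner bij_betw_imp_surj_on[OF from_corner_bij, symmetric] by auto
  finally show "bij_betw (from_corner sw r) {v \<in> V. P (depth v)} {w \<in> {..<n} \<times> {..<m}. P (fst w + snd w)}" .
qed

text \<open>A cell of a diagonal is determined by its row, so both bounds count rows.\<close>

lemma card_layer_le: "card {v \<in> V. depth v = k} \<le> Suc k" "card {v \<in> V. depth v = k} \<le> n"
proof -
  let ?L = "{w \<in> {..<n} \<times> {..<m}. fst w + snd w = k}"
  have eq: "card {v \<in> V. depth v = k} = card ?L" by (rule card_filter_from_corner)
  have inj: "inj_on fst ?L" by (auto simp: inj_on_def)
  have "card ?L \<le> card {..k}" by (rule card_inj_on_le[OF inj]) auto
  then show "card {v \<in> V. depth v = k} \<le> Suc k" unfolding eq by simp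
  have "card ?L \<le> card {..<n}" by (rule card_inj_on_le[OF inj]) auto
  then show "card {v \<in> V. depth v = k} \<le> n" unfolding eq by simp
qed

text \<open>All cells nearer than \<open>k\<close> lie in the \<open>K\<close> by \<open>K\<close>
  square at the corner. A bound uniform in \<open>k\<close> lets the harmonic sum be factored
  out.\<close>

lemma card_beyond_ge_square:
  assumes "k \<le> K"
  shows "real (n * m) - real (K * K) \<le> real (card {v \<in> V. k \<le> depth v})"
proof -
  let ?A = "{w \<in> {..<n} \<times> {..<m}. k \<le> fst w + snd w}"
  have "{..<n} \<times> {..<m} \<subseteq> ?A \<union> {..<K} \<times> {..<K}" using assms by auto
  then have "card ({..<n} \<times> {..<m}) \<le> card (?A \<union> {..<K} \<times> {..<K})" by (intro card_mono) auto
  also have "\<dots> \<le> card ?A + card ({..<K} \<times> {..<K})" by (rule card_Un_le)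
  finally have "n * m \<le> card ?A + K * K" by (simp add: card_cartesian_product)
  then have "real (n * m) \<le> real (card ?A) + real (K * K)"
    by (simp only: of_nat_le_iff flip: of_nat_add)
  then show ?thesis by (simp add: card_filter_from_corner)
qed

lemma card_beyond_ge_rows: "real n * real (m - k) \<le> real (card {v \<in> V. k \<le> depth v})"
proof -
  have "card ({..<n} \<times> {k..<m}) \<le> card {w \<in> {..<n} \<times> {..<m}. k \<le> fst w + snd w}"
    by (intro card_mono) auto
  then have "n * (m - k) \<le> card {v \<in> V. k \<le> depth v}"
    by (simp add: card_cartesian_product card_filter_from_corner)
  then show ?thesis by (simp only: of_nat_le_iff flip: of_nat_mult)
qed

lemmas loss_lower_bound =
  layered_loss_lower_bound[OF finite_V root_in grid_edges_verts grid_edges_finite,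
    where dist = depth and F = F for F]

text \<open>Every layer is bounded by \<open>n\<close>; this estimate serves the grids with a small
  shorter side.\<close>

lemma loss_ge_rows:
  assumes "spanning_tree V E F"
  shows "real n * (\<Sum>t=1..m - 1. (real t)\<^sup>2) \<le> loss F"
proof -
  have n: "0 < real n" using nm by simp
  have "(\<Sum>k\<in>{1..<m}. (real n * real (m - k))\<^sup>2 / real n) \<le> loss F"
  proof (rule loss_lower_bound[OF assms])
    show "real (card {v \<in> V. depth v = k}) \<le> real n" for k
      using card_layer_le(2)[of k] by (simp only: of_nat_le_iff)
    show "depth x \<le> Suc (depth y)" if "{x, y} \<in> E" for x y
      using that by (rule grid_edges_gap)
    show "real n * real (m - k) \<le> real (card {v \<in> V. k \<le> depth v})" for k
      by (rule card_beyond_ge_rows)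
  qed (use n in auto)
  also have "(\<Sum>k\<in>{1..<m}. (real n * real (m - k))\<^sup>2 / real n) = (\<Sum>t=1..m - 1. real n * (real t)\<^sup>2)"
    by (rule sum.reindex_bij_witness[of _ "\<lambda>t. m - t" "\<lambda>k. m - k"])
      (use n in \<open>auto simp: power2_eq_square\<close>)
  finally show ?thesis by (simp add: sum_distrib_left)
qed

text \<open>Layers before \<open>K\<close> yield the harmonic sum, layers from \<open>n\<close> to
  \<open>m - 1\<close> the row term. The two ranges are disjoint as
  \<open>K \<le> n\<close>.\<close>

lemma loss_ge_layers:
  assumes "spanning_tree V E F" "K \<le> n"
  shows "(real (n * m) - real (K * K))\<^sup>2 * (\<Sum>k=2..K. 1 / real k) +
           real n * (\<Sum>t=1..m - n. (real t)\<^sup>2) \<le> loss F"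
proof -
  have n: "0 < real n" using nm by simp
  define u where "u k = (if k < n then real (Suc k) else real n)" for k
  define s where "s k = (if k < n then real (n * m) - real (K * K) else real n * real (m - k))" for k
  have KK: "K * K \<le> n * m" using assms(2) nm by (intro mult_mono) auto
  have "(\<Sum>k\<in>{1..<K} \<union> {n..<m}. (s k)\<^sup>2 / u k) \<le> loss F"
  proof (rule loss_lower_bound[OF assms(1)])
    show "real (card {v \<in> V. depth v = k}) \<le> u k" for k
      using card_layer_le[of k] by (auto simp only: u_def of_nat_le_iff split: if_split)
    show "depth x \<le> Suc (depth y)" if "{x, y} \<in> E" for x y
      using that by (rule grid_edges_gap)
    show "s k \<le> real (card {v \<in> V. k \<le> depth v})" if "k \<in> {1..<K} \<union> {n..<m}" for k
      using that card_beyond_ge_square[of k K] card_beyond_ge_rows[of k] assms(2)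
      by (auto simp: s_def)
    show "0 \<le> s k" for k using KK of_nat_mono[OF KK, where 'a = real] by (auto simp: s_def)
  qed (use n nm assms(2) in \<open>auto simp: u_def\<close>)
  also have "(\<Sum>k\<in>{1..<K} \<union> {n..<m}. (s k)\<^sup>2 / u k) =
      (\<Sum>k\<in>{1..<K}. (s k)\<^sup>2 / u k) + (\<Sum>k\<in>{n..<m}. (s k)\<^sup>2 / u k)"
    using assms(2) by (intro sum.union_disjoint) auto
  \<comment> \<open>Layer \<open>k\<close> has at most \<open>k + 1\<close> cells, hence the index
    shift; without the root layer the sum starts at 2.\<close>
  also have "(\<Sum>k\<in>{1..<K}. (s k)\<^sup>2 / u k) = (\<Sum>k=2..K. (real (n * m) - real (K * K))\<^sup>2 * (1 / real k))"
    by (rule sum.reindex_bij_witness[of _ "\<lambda>k. k - 1" Suc])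
      (use assms(2) in \<open>auto simp: s_def u_def\<close>)
  also have "(\<Sum>k\<in>{n..<m}. (s k)\<^sup>2 / u k) = (\<Sum>t=1..m - n. real n * (real t)\<^sup>2)"
    by (rule sum.reindex_bij_witness[of _ "\<lambda>t. m - t" "\<lambda>k. m - k"])
      (use n in \<open>auto simp: s_def u_def power2_eq_square\<close>)
  finally show ?thesis by (simp only: sum_distrib_left)
qed

end

section \<open>The explicit tree in the actual grid\<close>

locale rooted_grid_tree = rooted_grid +
  fixes K L :: nat
  assumes K_pow: "2 ^ floor_log K = K" and L_pos: "0 < L" and n_le: "n \<le> L * K" and K_le: "K \<le> n"
begin

sublocale corner_grid n m K L
  using K_pow L_pos n_le K_le nm by unfold_locales auto

abbreviation par :: "nat \<times> nat \<Rightarrow> nat \<times> nat" where "par \<equiv> grid_parent sw K L r"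

lemma par_props:
  assumes "v \<in> V" "v \<noteq> r"
  shows "from_corner sw r (par v) = corner_parent K L (from_corner sw r v)"
    and "par v \<in> V" and "{v, par v} \<in> E"
proof -
  obtain i j where c: "from_corner sw r v = (i, j)" by fastforce
  have ij: "i < n" "j < m" using bij_betwE[OF from_corner_bij] assms(1) c by force+
  have "0 < i + j" using assms(2) c from_corner_0_iff[of v] by auto
  note pos = keeps_row_pos[OF ij(1) _ this] not_keeps_row_pos[OF _ this]
  obtain x y a b where v: "v = (x, y)" "r = (a, b)" by fastforce
  have xy: "x < n0" "y < m0" "a < n0" "b < m0"
    using assms(1) root_in v by (auto simp: grid_verts_def)
  have eij: "i = (if sw then gap b y else gap a x)" "j = (if sw then gap a x else gap b y)"
    using c v by (auto simp: from_corner_def split: if_splits)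
  have p: "par v = (if keeps_row K L i j = sw then (toward a x, y) else (x, toward b y))"
    using c v by (simp add: grid_parent_def)
  \<comment> \<open>The coordinate that changes still differs from that of the root, so
    \<open>toward\<close> really moves closer.\<close>
  have g: "0 < (if keeps_row K L i j = sw then gap a x else gap b y)"
    using pos eij by (auto split: if_splits)
  show "from_corner sw r (par v) = corner_parent K L (from_corner sw r v)"
    unfolding c p using g eij
    by (auto simp: v from_corner_def corner_parent_def gap_toward split: if_splits)
  show "par v \<in> V" unfolding p using xy by (auto simp: grid_verts_def toward_less)
  then have "(fst (par v), snd (par v)) \<in> V" by simp
  moreover have "\<bar>int x - int (fst (par v))\<bar> + \<bar>int y - int (snd (par v))\<bar> = 1"
    unfolding p using g by (simp add: toward_adjacent split: if_splits)
  moreover have "{v, par v} = {(x, y), (fst (par v), snd (par v))}" by (simp add: v(1))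
  moreover have "(x, y) \<in> V" using assms(1) v(1) by simp
  ultimately show "{v, par v} \<in> E" unfolding grid_edges_def by blast
qed

sublocale parent_map V r par depth
proof
  show "finite V" "r \<in> V" by (rule finite_V, rule root_in)
  fix v assume v: "v \<in> V" "v \<noteq> r"
  show "par v \<in> V" by (rule par_props(2)[OF v])
  have "from_corner sw r v \<in> cells" using bij_betwE[OF from_corner_bij] v(1) by blast
  moreover have "from_corner sw r v \<noteq> (0, 0)"
    using v by simp
  ultimately show "depth (par v) < depth v"
    unfolding depth_from_corner par_props(1)[OF v] by (rule corner_parent_decreasing)
qed

lemma parent_edges_subset: "parent_edges \<subseteq> E"
  using par_props(3) by (auto simp: parent_edges_def)

lemma grid_tree_spanning: "spanning_tree V E parent_edges"
  by (rule parent_edges_spanning_tree[OF parent_edges_subset])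

lemma from_corner_nonroot: "bij_betw (from_corner sw r) (V - {r}) (cells - {(0, 0)})"
  using bij_betw_DiffI[OF from_corner_bij, of "{r}" "{(0, 0)}"] root_in nm by (auto simp: bij_betw_def)

text \<open>The load pulled back along \<open>from_corner\<close> serves as potential: the bijection
  maps the children of \<open>v\<close> onto the children of its image.\<close>

lemma card_desc_le_load:
  assumes "v \<in> V - {r}"
  shows "real (card (desc v)) \<le> load (fst (from_corner sw r v)) (snd (from_corner sw r v))"
proof (rule card_desc_le[OF _ assms])
  fix v assume v: "v \<in> V - {r}"
  let ?c = "from_corner sw r"
  let ?g = "\<lambda>w. load (fst w) (snd w)"
  have inj: "inj_on ?c V" using from_corner_bij by (simp add: bij_betw_def)
  have img: "?c ` {w \<in> V - {r}. par w = v} = {w \<in> cells - {(0, 0)}. corner_parent K L w = ?c v}"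
  proof (intro set_eqI iffI)
    fix w assume "w \<in> ?c ` {w \<in> V - {r}. par w = v}"
    then show "w \<in> {w \<in> cells - {(0, 0)}. corner_parent K L w = ?c v}"
      using bij_betwE[OF from_corner_nonroot] par_props(1) by auto
  next
    fix w assume w: "w \<in> {w \<in> cells - {(0, 0)}. corner_parent K L w = ?c v}"
    then obtain u where u: "u \<in> V - {r}" "w = ?c u"
      using bij_betw_imp_surj_on[OF from_corner_nonroot] by blast
    with w par_props[of u] have "?c (par u) = ?c v" "par u \<in> V" by auto
    with inj v have "par u = v" by (auto dest: inj_onD)
    with u show "w \<in> ?c ` {w \<in> V - {r}. par w = v}" by auto
  qed
  have inj': "inj_on ?c {w \<in> V - {r}. par w = v}" by (rule inj_on_subset[OF inj]) auto
  have "(\<Sum>w\<in>{w \<in> V - {r}. par w = v}. ?g (?c w)) =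
      (\<Sum>w\<in>{w \<in> cells - {(0, 0)}. corner_parent K L w = ?c v}. ?g w)"
    unfolding img[symmetric] by (rule sum.reindex[OF inj', unfolded comp_def, symmetric])
  moreover have "?c v \<in> cells" using bij_betwE[OF from_corner_bij] v by blast
  ultimately show "1 + (\<Sum>w\<in>{w \<in> V - {r}. par w = v}. ?g (?c w)) \<le> ?g (?c v)"
    using load_children by simp
qed

lemma grid_tree_loss_le:
  "loss parent_edges \<le> 9 / 8 * root_load\<^sup>2 * (\<Sum>k=2..K. 1 / real k) + real n * real K * branch\<^sup>2
        + real n * (\<Sum>t=1..m. (real t)\<^sup>2)"
proof -
  have "loss parent_edges = (\<Sum>v\<in>V - {r}. (real (card (desc v)))\<^sup>2)"
    by (rule loss_parent_edges[OF parent_edges_subset])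
  also have "\<dots> \<le> (\<Sum>v\<in>V - {r}. (load (fst (from_corner sw r v)) (snd (from_corner sw r v)))\<^sup>2)"
    by (intro sum_mono power_mono card_desc_le_load) auto
  also have "\<dots> = (\<Sum>v\<in>cells - {(0, 0)}. (load (fst v) (snd v))\<^sup>2)"
    by (rule sum.reindex_bij_betw[OF from_corner_nonroot, of "\<lambda>w. (load (fst w) (snd w))\<^sup>2"])
  also note sum_load_squares
  finally show ?thesis .
qed

text \<open>The first factor counts the non-root vertices, so the bound vanishes on the grid with a
  single vertex.\<close>

lemma grid_tree_loss_crude: "loss parent_edges \<le> (real (n * m) - 1) * (real (n * m))\<^sup>2"
proof -
  have "loss parent_edges = (\<Sum>v\<in>V - {r}. (real (card (desc v)))\<^sup>2)"
    by (rule loss_parent_edges[OF parent_edges_subset])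
  also have "\<dots> \<le> (\<Sum>v\<in>V - {r}. (real (n * m))\<^sup>2)"
  proof (intro sum_mono power_mono)
    fix v
    have "card (desc v) \<le> card V" by (rule card_mono[OF finite_V]) (auto simp: desc_def)
    then show "real (card (desc v)) \<le> real (n * m)" unfolding card_V by (simp only: of_nat_le_iff)
  qed simp
  also have "\<dots> = real (card (V - {r})) * (real (n * m))\<^sup>2" by simp
  also have "card (V - {r}) = n * m - 1" using root_in finite_V by (simp add: card_V)
  also have "real (n * m - 1) = real (n * m) - 1" using nm by (subst of_nat_diff) auto
  finally show ?thesis .
qed

lemma opt_ge:
  assumes "\<And>F. spanning_tree V E F \<Longrightarrow> z \<le> loss F"
  shows "z \<le> ednr_opt V E r (\<lambda>_. 1) (\<lambda>_. 1)"
proof -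
  have "{F. spanning_tree V E F} \<subseteq> Pow E" by (auto simp: spanning_tree_def)
  then have "finite {F. spanning_tree V E F}"
    by (rule finite_subset) (simp add: grid_edges_finite)
  then show ?thesis
    unfolding ednr_opt_def using grid_tree_spanning assms by (subst Min_ge_iff) auto
qed

end

section \<open>The approximation factor\<close>

text \<open>
  With \<open>g = 2 ^ tri_exp n\<close>, which is about \<open>sqrt (log n)\<close>, the triangle has side \<open>K \<approx> n / g\<close>. Small \<open>K / n\<close> makes
  the branches leaving the triangle nearly equal, while the columns feeding the blocks cost \<open>O(g N\<^sup>2)\<close>,
  which must stay below the \<open>N\<^sup>2 ln K\<close> spent inside the triangle (\<open>N = n m\<close>).
\<close>

definition tri_exp :: "nat \<Rightarrow> nat" where
  "tri_exp n = floor_log (floor_log n) div 2"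

definition tri_size :: "nat \<Rightarrow> nat" where
  "tri_size n = 2 ^ (floor_log n - tri_exp n)"

text \<open>A quotient rounded up, so that the blocks cover all rows.\<close>

definition block_size :: "nat \<Rightarrow> nat" where
  "block_size n = (n + tri_size n - 1) div tri_size n"

text \<open>The second branch concerns only finitely many \<open>n\<close> and does not affect the
  limit.\<close>

definition approx_error :: "nat \<Rightarrow> real" where
  "approx_error n = (if 0 < tri_exp n then 200 / 2 ^ tri_exp n else 24 * (real n)\<^sup>2)"

section \<open>Growth of the triangle parameters\<close>

lemma floor_log_at_top: "filterlim floor_log at_top sequentially"
  unfolding filterlim_at_top
proof
  fix z :: nat
  show "eventually (\<lambda>n. z \<le> floor_log n) sequentially"
    using eventually_ge_at_top[of "2 ^ z"]
  proof eventually_elim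
    case (elim n)
    then show ?case using floor_log_le_iff[OF elim] by simp
  qed
qed

lemma tri_exp_at_top: "filterlim tri_exp at_top sequentially"
proof -
  have "filterlim (\<lambda>k::nat. k div 2) at_top sequentially"
    unfolding filterlim_at_top
  proof
    fix z :: nat
    show "eventually (\<lambda>k. z \<le> k div 2) sequentially"
      using eventually_ge_at_top[of "2 * z"] by eventually_elim simp
  qed
  from filterlim_compose[OF this filterlim_compose[OF floor_log_at_top floor_log_at_top]]
  show ?thesis by (simp add: tri_exp_def[abs_def])
qed

lemma approx_error_tendsto_0: "approx_error \<longlonglongrightarrow> 0"
proof -
  have "(\<lambda>k. 200 * (1 / 2) ^ k :: real) \<longlonglongrightarrow> 200 * 0"
    by (intro tendsto_mult tendsto_const LIMSEQ_power_zero) simp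
  then have "(\<lambda>n. 200 * (1 / 2) ^ tri_exp n :: real) \<longlonglongrightarrow> 0"
    using filterlim_compose[OF _ tri_exp_at_top] by fastforce
  moreover have "eventually (\<lambda>n. 200 * (1 / 2) ^ tri_exp n = approx_error n) sequentially"
    using filterlim_at_top[THEN iffD1, OF tri_exp_at_top, rule_format, of 1]
    by eventually_elim (simp add: approx_error_def power_divide)
  ultimately show ?thesis by (rule Lim_transform_eventually)
qed

lemma two_times_le_four_power: "2 * c \<le> (4::nat) ^ c"
  using less_exp[of "2 * c"] by (simp add: power_mult)

text \<open>With \<open>g = 2 ^ tri_exp n\<close> the first bound reads
  \<open>g^2 \<le> floor_log n\<close>; the second then follows from
  \<open>2 * c \<le> 4 ^ c\<close>.\<close>

lemma tri_exp_bound: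
  assumes "0 < floor_log n"
  shows "4 ^ tri_exp n \<le> floor_log n" "2 * tri_exp n \<le> floor_log n"
proof -
  have "(4::nat) ^ tri_exp n = 2 ^ (2 * tri_exp n)" by (simp add: power_mult)
  also have "\<dots> \<le> 2 ^ floor_log (floor_log n)"
    by (intro power_increasing) (auto simp: tri_exp_def)
  also have "\<dots> \<le> floor_log n" using assms by (intro floor_log_exp2_le) auto
  finally show "4 ^ tri_exp n \<le> floor_log n" .
  then show "2 * tri_exp n \<le> floor_log n" using two_times_le_four_power[of "tri_exp n"] by linarith
qed

lemma tri_exp_le: "2 * tri_exp n \<le> floor_log n"
  using tri_exp_bound(2)[of n] by (cases "floor_log n = 0") (auto simp: tri_exp_def)

text \<open>\<open>tri_size n * 2 ^ tri_exp n\<close> is the largest power of two not exceeding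
  \<open>n\<close>, which gives both estimates against \<open>n\<close>.\<close>

lemma tri_size_bounds:
  assumes "1 \<le> n"
  shows "2 ^ floor_log (tri_size n) = tri_size n"
    "0 < tri_size n"
    "tri_size n * 2 ^ tri_exp n \<le> n" "n \<le> 2 * (tri_size n * 2 ^ tri_exp n)"
    "tri_size n \<le> n"
proof -
  have eq: "tri_size n * 2 ^ tri_exp n = 2 ^ floor_log n"
    using tri_exp_le[of n] by (simp add: tri_size_def flip: power_add)
  show "2 ^ floor_log (tri_size n) = tri_size n" "0 < tri_size n" by (simp_all add: tri_size_def)
  show le: "tri_size n * 2 ^ tri_exp n \<le> n" unfolding eq using assms by (intro floor_log_exp2_le) auto
  show "n \<le> 2 * (tri_size n * 2 ^ tri_exp n)" unfolding eq by (rule floor_log_exp2_ge)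
  have "tri_size n * 1 \<le> tri_size n * 2 ^ tri_exp n" by (intro mult_left_mono) auto
  with le show "tri_size n \<le> n" by linarith
qed

lemma block_size_bounds:
  assumes "1 \<le> n"
  shows "0 < block_size n" "n \<le> block_size n * tri_size n" "block_size n * tri_size n \<le> n + tri_size n"
proof -
  let ?K = "tri_size n"
  note K = tri_size_bounds[OF assms]
  have "?K \<le> n + ?K - 1" using assms by simp
  then show "0 < block_size n" using K(2) by (auto simp: block_size_def div_greater_zero_iff)
  have "n + ?K - 1 = block_size n * ?K + (n + ?K - 1) mod ?K" by (simp add: block_size_def)
  moreover have "(n + ?K - 1) mod ?K < ?K" using K(2) by (rule mod_less_divisor)
  ultimately show "n \<le> block_size n * ?K" "block_size n * ?K \<le> n + ?K" by linarith+
qed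

section \<open>Harmonic sums, sums of squares and the final inequality in
  \<open>1 / g\<close>\<close>

text \<open>Each dyadic block of summands contributes at least one half.\<close>

lemma harmonic_ge: "real q / 2 \<le> (\<Sum>k=2..2 ^ q. 1 / real k)"
proof (induction q)
  case (Suc q)
  have "(\<Sum>k\<in>{2 ^ q<..2 ^ Suc q::nat}. 1 / (2 * 2 ^ q)) \<le> (\<Sum>k\<in>{2 ^ q<..2 ^ Suc q}. 1 / real k)"
  proof (rule sum_mono)
    fix k :: nat assume k: "k \<in> {2 ^ q<..2 ^ Suc q}"
    then have "real k \<le> real (2 ^ Suc q)" by (simp only: of_nat_le_iff greaterThanAtMost_iff)
    then show "1 / (2 * 2 ^ q) \<le> 1 / real k" using k by (intro divide_left_mono) auto
  qed
  also have "(\<Sum>k\<in>{2 ^ q<..2 ^ Suc q::nat}. 1 / (2 * 2 ^ q)) = (1 / 2 :: real)" by simp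
  finally have half: "1 / 2 \<le> (\<Sum>k\<in>{2 ^ q<..2 ^ Suc q}. 1 / real k)" .
  have "{2..2 ^ Suc q} = {2..2 ^ q} \<union> {2 ^ q<..2 ^ Suc q::nat}"
    using one_le_power[of "2::nat" q] by auto
  moreover have "{2..2 ^ q} \<inter> {2 ^ q<..2 ^ Suc q::nat} = {}" by auto
  ultimately have "(\<Sum>k=2..2 ^ Suc q. 1 / real k) =
      (\<Sum>k=2..2 ^ q. 1 / real k) + (\<Sum>k\<in>{2 ^ q<..2 ^ Suc q}. 1 / real k)"
    by (simp add: sum.union_disjoint)
  with Suc half show ?case by simp
qed simp

text \<open>The harmonic sum dominates \<open>g^2\<close>, up to the factor 4. This is what makes an
  error of order \<open>g N^2\<close> small against \<open>N^2\<close> times that sum.\<close>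

lemma harmonic_tri_size_ge:
  assumes "0 < tri_exp n"
  shows "(2 ^ tri_exp n)\<^sup>2 \<le> 4 * (\<Sum>k=2..tri_size n. 1 / real k)"
proof -
  have a: "0 < floor_log n" using assms tri_exp_le[of n] by linarith
  have "real ((2 ^ tri_exp n)\<^sup>2) = real (4 ^ tri_exp n)" by (simp add: power2_eq_square flip: power_mult_distrib)
  also have "\<dots> \<le> real (2 * (floor_log n - tri_exp n))"
    using tri_exp_bound[OF a] by (intro of_nat_mono) linarith
  also have "\<dots> = 4 * (real (floor_log n - tri_exp n) / 2)" by simp
  also have "\<dots> \<le> 4 * (\<Sum>k=2..tri_size n. 1 / real k)"
    unfolding tri_size_def by (intro mult_left_mono harmonic_ge) simp
  finally show ?thesis by simp
qed

lemma sum_squares_ge: "(real k) ^ 3 \<le> 3 * (\<Sum>t=1..k. (real t)\<^sup>2)"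
proof (induction k)
  case (Suc k)
  have "(real (Suc k)) ^ 3 \<le> real k ^ 3 + 3 * (real (Suc k))\<^sup>2"
    by (simp add: power2_eq_square power3_eq_cube algebra_simps)
  with Suc show ?case by simp
qed simp

lemma sum_squares_tail:
  assumes "n \<le> m"
  shows "(\<Sum>t=1..m. (real t)\<^sup>2) \<le> (\<Sum>t=1..m - n. (real t)\<^sup>2) + real n * (real m)\<^sup>2"
proof -
  have "{1..m} = {1..m - n} \<union> {m - n<..m}" using assms by auto
  moreover have "{1..m - n} \<inter> {m - n<..m} = {}" by auto
  ultimately have "(\<Sum>t=1..m. (real t)\<^sup>2) = (\<Sum>t=1..m - n. (real t)\<^sup>2) + (\<Sum>t\<in>{m - n<..m}. (real t)\<^sup>2)"
    by (simp add: sum.union_disjoint)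
  also have "(\<Sum>t\<in>{m - n<..m}. (real t)\<^sup>2) \<le> (\<Sum>t\<in>{m - n<..m}. (real m)\<^sup>2)"
    by (intro sum_mono power_mono) auto
  also have "\<dots> = real n * (real m)\<^sup>2" using assms by simp
  finally show ?thesis by simp
qed

text \<open>Here \<open>x\<close> is \<open>1 / g\<close>: \<open>1 + 4 * x\<close> is the excess of
  the root load, \<open>34 * x\<close> collects column and row errors, and \<open>1 - x^2\<close> is
  the part of \<open>N\<close> kept by the lower bound. With \<open>x^2 \<le> x / 2\<close> and
  \<open>x^3 \<le> x / 4\<close> all error terms fit below \<open>200 * x\<close>.\<close>

lemma factor_inequality:
  fixes x :: real
  assumes "0 \<le> x" "x \<le> 1 / 2"
  shows "9 / 8 * (1 + 4 * x)\<^sup>2 + 34 * x \<le> (9 / 8 + 200 * x) * (1 - x\<^sup>2)\<^sup>2"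
proof -
  have x2: "x\<^sup>2 \<le> x / 2" "0 \<le> x\<^sup>2"
    using mult_right_mono[OF assms(2,1)] by (auto simp: power2_eq_square)
  have x3: "x * x\<^sup>2 \<le> x / 4"
    using mult_left_mono[OF x2(1) assms(1)] x2(1) by (simp add: power2_eq_square)
  have "9 / 8 * (1 + 4 * x)\<^sup>2 + 34 * x = 9 / 8 + 43 * x + 18 * x\<^sup>2"
    by (simp add: power2_eq_square field_simps)
  also have "\<dots> \<le> 9 / 8 + 200 * x - 9 / 4 * x\<^sup>2 - 400 * (x * x\<^sup>2)"
    using x2 x3 assms by linarith
  also have "\<dots> = (9 / 8 + 200 * x) * (1 - 2 * x\<^sup>2)" by (simp add: field_simps)
  also have "\<dots> \<le> (9 / 8 + 200 * x) * (1 - x\<^sup>2)\<^sup>2"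
    using assms by (intro mult_left_mono) (auto simp: power2_eq_square algebra_simps)
  finally show ?thesis .
qed

section \<open>Comparison of the tree with the optimum\<close>

context rooted_grid_tree
begin

text \<open>The triangle term and the row term \<open>M\<close> are each compared with their
  counterpart in \<open>loss_ge_layers\<close>; all remaining errors are turned into multiples of
  \<open>x * h * N^2\<close>.\<close>

lemma loss_le_large:
  fixes g h :: real
  assumes g: "2 \<le> g" "real K * g \<le> real n" "real n \<le> 2 * (real K * g)"
    and LK: "L * K \<le> n + K"
    and h: "h = (\<Sum>k=2..K. 1 / real k)" "g\<^sup>2 \<le> 4 * h"
  shows "loss parent_edges \<le> (9 / 8 + 200 / g) * ednr_opt V E r (\<lambda>_. 1) (\<lambda>_. 1)"
proof -
  define N where "N = real n * real m"
  define x where "x = 1 / g"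
  define M where "M = real n * (\<Sum>t=1..m - n. (real t)\<^sup>2)"
  have pos: "0 < real K" "0 < real n" "real n \<le> real m" "0 < g" "0 \<le> h"
    using K_pos nm g by (auto simp: h sum_nonneg)
  have x: "0 \<le> x" "x \<le> 1 / 2" using g by (auto simp: x_def)
  have N: "0 \<le> N" by (simp add: N_def)
  have Kn: "real K \<le> real n * x" using g pos by (simp add: x_def field_simps)
  also have "\<dots> \<le> real m * x" using pos x by (intro mult_right_mono) auto
  finally have Km: "real K \<le> real m * x" .
  have nK: "real n * real K \<le> N * x"
    using mult_left_mono[OF Km, of "real n"] by (simp add: N_def mult.assoc)
  have mK: "real m * real K \<le> N * x"
    using mult_left_mono[OF Kn, of "real m"] by (simp add: N_def mult_ac)
  have KK: "real K * real K \<le> N * x\<^sup>2"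
    using mult_mono[OF Kn Km] pos x by (simp add: N_def power2_eq_square mult_ac)
  have K1: "real K \<le> real K * real K" using K_pos by (cases K) auto
  have x2: "x\<^sup>2 \<le> x" using x by (simp add: power2_eq_square mult_left_le)
  have "real (L * K) \<le> real (n + K)" using LK by (simp only: of_nat_le_iff)
  then have "real m * (real L * real K) \<le> real m * (real n + real K)"
    by (intro mult_left_mono) auto
  then have bK: "branch * real K \<le> N * (1 + 2 * x)"
    using nK mK by (simp add: branch_def algebra_simps N_def)
  have b0: "0 \<le> branch" by (simp add: branch_def)
  have "N * x\<^sup>2 \<le> N * x" using x2 N by (rule mult_left_mono)
  then have tot: "root_load \<le> N * (1 + 4 * x)"
    using bK KK K1 by (simp add: root_load_def algebra_simps)
  have t0: "0 \<le> root_load" using b0 by (simp add: root_load_def)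
  have tot2: "9 / 8 * root_load\<^sup>2 * h \<le> 9 / 8 * (N * (1 + 4 * x))\<^sup>2 * h"
    using tot t0 pos by (intro mult_right_mono mult_left_mono power_mono) auto
  \<comment> \<open>Replacing \<open>n\<close> by \<open>2 * K * g\<close> completes the square of
    \<open>branch * K\<close>, which is at most \<open>2 * N\<close>.\<close>
  have "real n * real K * branch\<^sup>2 \<le> 2 * (real K * g) * real K * branch\<^sup>2"
    using g pos by (intro mult_right_mono) auto
  also have "\<dots> = 2 * g * (branch * real K)\<^sup>2" by (simp add: power2_eq_square)
  also have "\<dots> \<le> 2 * g * (N * 2)\<^sup>2"
  proof (intro mult_left_mono power_mono)
    have "N * (1 + 2 * x) \<le> N * 2" using x N by (intro mult_left_mono) auto
    with bK show "branch * real K \<le> N * 2" by linarith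
  qed (use b0 pos in auto)
  finally have br: "real n * real K * branch\<^sup>2 \<le> 8 * g * N\<^sup>2" by (simp add: power2_eq_square)
  \<comment> \<open>The rows of the tree exceed those of the lower bound only by the
    \<open>n\<close> largest squares, at most \<open>N^2\<close> in total.\<close>
  have "(real n * (\<Sum>t=1..m. (real t)\<^sup>2)) \<le> real n * ((\<Sum>t=1..m - n. (real t)\<^sup>2) + real n * (real m)\<^sup>2)"
    using sum_squares_tail[OF nm(2)] by (intro mult_left_mono) auto
  then have tail: "real n * (\<Sum>t=1..m. (real t)\<^sup>2) \<le> M + N\<^sup>2"
    by (simp add: M_def N_def power2_eq_square algebra_simps)
  have gx: "g * x = 1" using pos by (simp add: x_def)
  have hx: "1 \<le> 4 * h * x\<^sup>2"
    using mult_right_mono[OF h(2), of "x\<^sup>2"] gx by (simp flip: power_mult_distrib)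
  \<comment> \<open>From \<open>1 \<le> 4 * h * x^2\<close> follow \<open>g \<le> 4 * h * x\<close>
    and \<open>1 \<le> 2 * h * x\<close>; hence \<open>34 = 8 * 4 + 2\<close>.\<close>
  have "8 * g + 1 \<le> 34 * x * h"
  proof -
    have "g * 1 \<le> g * (4 * h * x\<^sup>2)" using hx pos by (intro mult_left_mono) auto
    also have "\<dots> = 4 * h * x * (g * x)" by (simp add: power2_eq_square)
    also have "\<dots> = 4 * h * x" using gx by simp
    finally have "g \<le> 4 * h * x" by simp
    moreover have "4 * h * x\<^sup>2 \<le> 2 * h * x"
      using mult_left_mono[OF x(2), of "4 * h * x"] x pos by (simp add: power2_eq_square)
    ultimately show ?thesis using hx by (simp add: algebra_simps)
  qed
  then have "(8 * g + 1) * N\<^sup>2 \<le> 34 * x * h * N\<^sup>2" by (rule mult_right_mono) simp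
  then have "8 * g * N\<^sup>2 + N\<^sup>2 \<le> 34 * x * h * N\<^sup>2" by (simp add: distrib_right)
  then have "loss parent_edges \<le> 9 / 8 * (N * (1 + 4 * x))\<^sup>2 * h + 34 * x * h * N\<^sup>2 + M"
    using grid_tree_loss_le tot2 br tail unfolding h(1)[symmetric] by linarith
  also have "\<dots> = N\<^sup>2 * h * (9 / 8 * (1 + 4 * x)\<^sup>2 + 34 * x) + M"
    unfolding power_mult_distrib by (simp only: distrib_left mult_ac)
  also have "\<dots> \<le> N\<^sup>2 * h * ((9 / 8 + 200 * x) * (1 - x\<^sup>2)\<^sup>2) + (9 / 8 + 200 * x) * M"
  proof (intro add_mono mult_left_mono factor_inequality x)
    have "0 \<le> M" by (simp add: M_def sum_nonneg)
    with x show "M \<le> (9 / 8 + 200 * x) * M"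
      using mult_right_mono[of 1 "9 / 8 + 200 * x" M] by simp
  qed (use pos in auto)
  also have "\<dots> = (9 / 8 + 200 * x) * ((N * (1 - x\<^sup>2))\<^sup>2 * h + M)"
    unfolding power_mult_distrib by (simp only: distrib_left mult_ac)
  also have "\<dots> \<le> (9 / 8 + 200 * x) * ednr_opt V E r (\<lambda>_. 1) (\<lambda>_. 1)"
  proof (intro mult_left_mono opt_ge)
    fix F assume F: "spanning_tree V E F"
    have "x\<^sup>2 \<le> 1" using x2 x by linarith
    moreover have "N * (1 - x\<^sup>2) \<le> real (n * m) - real (K * K)"
      using KK by (simp add: N_def algebra_simps)
    ultimately have "(N * (1 - x\<^sup>2))\<^sup>2 * h \<le> (real (n * m) - real (K * K))\<^sup>2 * h"
      using N pos by (intro mult_right_mono power_mono) auto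
    with loss_ge_layers[OF F K_le] show "(N * (1 - x\<^sup>2))\<^sup>2 * h + M \<le> loss F"
      unfolding h(1)[symmetric] M_def by linarith
  qed (use x in auto)
  finally show ?thesis by (simp add: x_def)
qed

text \<open>The loss is at most \<open>(n * m)^3\<close>, the optimum at least
  \<open>n * (m - 1)^3 / 3\<close>, and \<open>m \<le> 2 * (m - 1)\<close> for
  \<open>m \<ge> 2\<close>; hence \<open>24 = 8 * 3\<close>. For \<open>m = 1\<close> the loss is
  zero.\<close>

lemma loss_le_small: "loss parent_edges \<le> 24 * (real n)\<^sup>2 * ednr_opt V E r (\<lambda>_. 1) (\<lambda>_. 1)"
proof -
  let ?opt = "ednr_opt V E r (\<lambda>_. 1) (\<lambda>_. 1)"
  have opt: "real n * (\<Sum>t=1..m - 1. (real t)\<^sup>2) \<le> ?opt"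
    by (rule opt_ge[OF loss_ge_rows])
  show ?thesis
  proof (cases "m = 1")
    case True
    then have "n = 1" using nm by simp
    with True grid_tree_loss_crude opt show ?thesis by simp
  next
    case False
    then have m: "2 \<le> m" using nm by simp
    have "loss parent_edges \<le> real (n * m) ^ 3"
    proof -
      have "(real (n * m) - 1) * (real (n * m))\<^sup>2 \<le> real (n * m) * (real (n * m))\<^sup>2"
        by (intro mult_right_mono) auto
      with grid_tree_loss_crude show ?thesis
        by (simp only: power3_eq_cube power2_eq_square mult.assoc)
    qed
    also have "\<dots> \<le> (real n * (2 * real (m - 1))) ^ 3"
      using m by (simp only: of_nat_mult) (intro power_mono mult_left_mono; simp)
    also have "\<dots> = 8 * real n ^ 3 * real (m - 1) ^ 3" by (simp add: power_mult_distrib)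
    also have "\<dots> \<le> 8 * real n ^ 3 * (3 * (\<Sum>t=1..m - 1. (real t)\<^sup>2))"
      by (intro mult_left_mono sum_squares_ge) simp
    also have "\<dots> = 24 * (real n)\<^sup>2 * (real n * (\<Sum>t=1..m - 1. (real t)\<^sup>2))"
      by (simp add: power2_eq_square power3_eq_cube)
    also have "\<dots> \<le> 24 * (real n)\<^sup>2 * ?opt" by (intro mult_left_mono opt) simp
    finally show ?thesis .
  qed
qed

end

lemma (in rooted_grid) tri_size_tree: "rooted_grid_tree n0 m0 r (tri_size n) (block_size n)"
  using tri_size_bounds[OF nm(1)] block_size_bounds[OF nm(1)] by unfold_locales auto

lemma (in rooted_grid) tri_size_tree_loss:
  "loss (parent_map.parent_edges V r (grid_parent sw (tri_size n) (block_size n) r))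
     \<le> (9 / 8 + approx_error n) * ednr_opt V E r (\<lambda>_. 1) (\<lambda>_. 1)"
proof -
  interpret rooted_grid_tree n0 m0 r "tri_size n" "block_size n" by (rule tri_size_tree)
  note K = tri_size_bounds[OF nm(1)]
  show ?thesis
  proof (cases "0 < tri_exp n")
    case True
    have "real (tri_size n * 2 ^ tri_exp n) \<le> real n" "real n \<le> real (2 * (tri_size n * 2 ^ tri_exp n))"
      using K by (simp_all only: of_nat_le_iff)
    moreover have "(2::real) \<le> 2 ^ tri_exp n" using True self_le_power[of "2::real" "tri_exp n"] by simp
    ultimately have "loss parent_edges \<le> (9 / 8 + 200 / 2 ^ tri_exp n) * ednr_opt V E r (\<lambda>_. 1) (\<lambda>_. 1)"
      by (intro loss_le_large[OF _ _ _ block_size_bounds(3)[OF nm(1)] refl harmonic_tri_size_ge[OF True]])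
        auto
    then show ?thesis using True by (simp add: approx_error_def)
  next
    case False
    have "0 \<le> ednr_opt V E r (\<lambda>_. 1) (\<lambda>_. 1)"
      by (rule opt_ge) (auto simp: ednr_loss_def sum_nonneg)
    then show ?thesis using loss_le_small False by (simp add: approx_error_def algebra_simps)
  qed
qed

section \<open>The program\<close>

text \<open>Total correctness: termination is included, and the postcondition also receives the
  running time.\<close>

definition wp :: "com \<Rightarrow> (nat \<Rightarrow> ram \<Rightarrow> bool) \<Rightarrow> ram \<Rightarrow> bool" where
  "wp c Q s \<longleftrightarrow> (\<exists>t s'. exec c s t s' \<and> Q t s')"

lemma wp_Skip [simp]: "wp Skip Q s \<longleftrightarrow> Q 1 s"
  unfolding wp_def by (metis exec.Skip SkipE)

lemma wp_Assign [simp]: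
  "wp (Assign x a) Q s \<longleftrightarrow> Q (acost a + 1) (s\<lparr>regs := (regs s)(x := aval a s)\<rparr>)"
  unfolding wp_def by (metis exec.Assign AssignE)

lemma wp_Write [simp]: "wp (Write a) Q s \<longleftrightarrow> Q (acost a + 1) (s\<lparr>out := out s @ [aval a s]\<rparr>)"
  unfolding wp_def by (metis exec.Write WriteE)

lemma wp_Seq [simp]: "wp (Seq c d) Q s \<longleftrightarrow> wp c (\<lambda>t. wp d (\<lambda>u. Q (t + u))) s"
  unfolding wp_def by (metis exec.Seq SeqE)

lemma wp_If [simp]:
  "wp (IfNZ a c d) Q s \<longleftrightarrow>
     (if aval a s \<noteq> 0 then wp c (\<lambda>t. Q (acost a + 1 + t)) s else wp d (\<lambda>t. Q (acost a + 1 + t)) s)"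
proof (cases "aval a s = 0")
  case True
  have "exec (IfNZ a c d) s t s' \<longleftrightarrow> (\<exists>u. t = acost a + 1 + u \<and> exec d s u s')" for t s'
    using exec.IfFalse[OF True] by (auto elim!: IfE simp: True)
  with True show ?thesis by (auto simp: wp_def)
next
  case False
  have "exec (IfNZ a c d) s t s' \<longleftrightarrow> (\<exists>u. t = acost a + 1 + u \<and> exec c s u s')" for t s'
    using exec.IfTrue[OF False] False by (auto elim!: IfE)
  with False show ?thesis by (auto simp: wp_def)
qed

text \<open>For loops whose number \<open>N\<close> of rounds is known in advance; the invariant is
  indexed by the rounds already done, and \<open>T\<close> bounds the time of one body.\<close>

lemma wp_While_count:
  assumes init: "I 0 s"
    and step: "\<And>i s. I i s \<Longrightarrow> i < N \<Longrightarrow> aval a s \<noteq> 0 \<and> wp c (\<lambda>t s'. t \<le> T \<and> I (Suc i) s') s"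
    and stop: "\<And>s. I N s \<Longrightarrow> aval a s = 0"
    and post: "\<And>t s'. t \<le> N * (acost a + 1 + T) + (acost a + 1) \<Longrightarrow> I N s' \<Longrightarrow> Q t s'"
  shows "wp (WhileNZ a c) Q s"
proof -
  have "\<exists>t s'. exec (WhileNZ a c) s t s' \<and> t \<le> d * (acost a + 1 + T) + (acost a + 1) \<and> I N s'"
    if "I i s" "i + d = N" for i d s
    using that
  proof (induction d arbitrary: i s)
    case 0
    then have "I N s" by simp
    then show ?case using exec.WhileFalse[OF stop, of s c] by fastforce
  next
    case (Suc d)
    then obtain t s' where c: "aval a s \<noteq> 0" "exec c s t s'" "t \<le> T" "I (Suc i) s'"
      using step[of i s] by (auto simp: wp_def)
    moreover obtain u s'' where w: "exec (WhileNZ a c) s' u s''"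
      "u \<le> d * (acost a + 1 + T) + (acost a + 1)" "I N s''"
      using Suc.IH[OF c(4)] Suc.prems by auto
    ultimately have "exec (WhileNZ a c) s (acost a + 1 + t + u) s''"
      by (intro exec.WhileTrue)
    moreover have "acost a + 1 + t + u \<le> Suc d * (acost a + 1 + T) + (acost a + 1)"
      using c(3) w(2) by simp
    ultimately show ?case using w(3) by blast
  qed
  from this[OF init] post show ?thesis unfolding wp_def by fastforce
qed

text \<open>
  Register use: 0 counts the remaining vertices and 15 holds the address of the next one; 2 and 3 hold the two side
  lengths, 4 and 5 the triangle side \<open>K\<close> and the block size \<open>L\<close>; 8 and 9 are the coordinates of the current
  vertex, 10 and 11 its coordinates seen from the root with the shorter side first, and 12 is nonzero iff its
  parent lies in the same row.
\<close>

definition scan_dimensions :: com where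
  "scan_dimensions =
     Seq (Assign 0 (Mem (Const 0)))
    (Seq (Assign 15 (Const 4))
    (WhileNZ (Reg 0)
      (Seq (IfNZ (Minus (Plus (Mem (Reg 15)) (Const 1)) (Reg 2))
              (Assign 2 (Plus (Mem (Reg 15)) (Const 1))) Skip)
      (Seq (IfNZ (Minus (Plus (Mem (Plus (Reg 15) (Const 1))) (Const 1)) (Reg 3))
              (Assign 3 (Plus (Mem (Plus (Reg 15) (Const 1))) (Const 1))) Skip)
      (Seq (Assign 15 (Plus (Reg 15) (Const 2)))
           (Assign 0 (Minus (Reg 0) (Const 1))))))))"

text \<open>The first loop turns the shorter side into its floor logarithm (register 7) and the
  power of two below it (register 4). The second divides register 7 by four and halves register 4 as
  long as possible, the third divides by repeated subtraction, rounding up.\<close>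

definition compute_sizes :: com where
  "compute_sizes =
     Seq (IfNZ (Minus (Reg 2) (Reg 3)) (Assign 6 (Reg 3)) (Assign 6 (Reg 2)))
    (Seq (Assign 14 (Reg 6))
    (Seq (Assign 4 (Const 1))
    (Seq (Assign 7 (Const 0))
    (Seq (WhileNZ (Half (Reg 6))
            (Seq (Assign 6 (Half (Reg 6)))
            (Seq (Assign 4 (Plus (Reg 4) (Reg 4)))
                 (Assign 7 (Plus (Reg 7) (Const 1))))))
    (Seq (WhileNZ (Half (Half (Reg 7)))
            (Seq (Assign 7 (Half (Half (Reg 7))))
                 (Assign 4 (Half (Reg 4)))))
    (Seq (Assign 5 (Const 0))
         (WhileNZ (Reg 14)
            (Seq (Assign 14 (Minus (Reg 14) (Reg 4)))
                 (Assign 5 (Plus (Reg 5) (Const 1)))))))))))"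

text \<open>Truncated subtraction encodes comparisons: \<open>x + 1 - y\<close> is nonzero iff
  \<open>y \<le> x\<close>. Register 13 is doubled up to
  \<open>2 ^ floor_log (i + j)\<close>.\<close>

definition inner_test :: com where
  "inner_test =
     Seq (Assign 13 (Const 1))
    (Seq (Assign 6 (Plus (Reg 10) (Reg 11)))
    (Seq (WhileNZ (Minus (Plus (Reg 6) (Const 1)) (Plus (Reg 13) (Reg 13)))
            (Assign 13 (Plus (Reg 13) (Reg 13))))
         (Assign 12 (Minus (Plus (Plus (Reg 6) (Reg 6)) (Const 1))
                           (Plus (Reg 10) (Plus (Reg 13) (Reg 13)))))))"

text \<open>Register 13 obtains \<open>i div L\<close> by repeated subtraction.\<close>

definition outer_test :: com where
  "outer_test =
     Seq (Assign 13 (Const 0))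
    (Seq (Assign 6 (Reg 10))
    (Seq (WhileNZ (Minus (Plus (Reg 6) (Const 1)) (Reg 5))
            (Seq (Assign 6 (Minus (Reg 6) (Reg 5)))
                 (Assign 13 (Plus (Reg 13) (Const 1)))))
         (Assign 12 (Minus (Plus (Plus (Reg 13) (Reg 11)) (Const 1)) (Reg 4)))))"

definition write_toward :: "nat \<Rightarrow> nat \<Rightarrow> com" where
  "write_toward a x =
     IfNZ (Minus (Mem (Const a)) (Reg x)) (Write (Plus (Reg x) (Const 1)))
       (Write (Minus (Reg x) (Const 1)))"

definition write_edge :: com where
  "write_edge =
     Seq (Write (Reg 8))
    (Seq (Write (Reg 9))
    (IfNZ (Reg 12)
      (IfNZ (Minus (Reg 2) (Reg 3)) (Seq (write_toward 2 8) (Write (Reg 9)))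
        (Seq (Write (Reg 8)) (write_toward 3 9)))
      (IfNZ (Minus (Reg 2) (Reg 3)) (Seq (Write (Reg 8)) (write_toward 3 9))
        (Seq (write_toward 2 8) (Write (Reg 9))))))"

definition abs_diff :: "nat \<Rightarrow> nat \<Rightarrow> aexp" where
  "abs_diff a x = Plus (Minus (Reg x) (Mem (Const a))) (Minus (Mem (Const a)) (Reg x))"

definition load_vertex :: com where
  "load_vertex =
     Seq (Assign 8 (Mem (Reg 15)))
    (Seq (Assign 9 (Mem (Plus (Reg 15) (Const 1))))
    (IfNZ (Minus (Reg 2) (Reg 3))
       (Seq (Assign 10 (abs_diff 3 9)) (Assign 11 (abs_diff 2 8)))
       (Seq (Assign 10 (abs_diff 2 8)) (Assign 11 (abs_diff 3 9)))))"

definition process_vertex :: com where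
  "process_vertex =
     Seq load_vertex
    (IfNZ (Plus (Reg 10) (Reg 11))
       (Seq (IfNZ (Minus (Reg 4) (Plus (Reg 10) (Reg 11))) inner_test outer_test) write_edge)
       Skip)"

definition tree_program :: com where
  "tree_program =
     Seq scan_dimensions
    (Seq compute_sizes
    (Seq (Assign 0 (Mem (Const 0)))
    (Seq (Assign 15 (Const 4))
    (WhileNZ (Reg 0)
      (Seq process_vertex
      (Seq (Assign 15 (Plus (Reg 15) (Const 2)))
           (Assign 0 (Minus (Reg 0) (Const 1)))))))))"

section \<open>Correctness and running time of the program parts\<close>

lemma floor_log_le: "floor_log k \<le> k"
proof (cases "k = 0")
  case False
  have "floor_log k < 2 ^ floor_log k" by (rule less_exp)
  also have "\<dots> \<le> k" using False by (intro floor_log_exp2_le) auto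
  finally show ?thesis by simp
qed simp

lemma le_floor_log_iff: "0 < n \<Longrightarrow> 2 ^ i \<le> n \<longleftrightarrow> i \<le> floor_log n"
proof
  assume "0 < n" "2 ^ i \<le> n"
  then show "i \<le> floor_log n" using floor_log_le_iff[of "2 ^ i" n] by simp
next
  assume n: "0 < n" and "i \<le> floor_log n"
  then have "(2::nat) ^ i \<le> 2 ^ floor_log n" by (intro power_increasing) auto
  also have "\<dots> \<le> n" using n by (intro floor_log_exp2_le) auto
  finally show "2 ^ i \<le> n" .
qed

lemma wp_inner_test:
  assumes k: "k = regs s 10 + regs s 11" "0 < k"
    and post: "\<And>t s'. t \<le> 20 * k + 50 \<Longrightarrow> mem s' = mem s \<Longrightarrow> out s' = out s \<Longrightarrow>
      (\<And>x. x \<notin> {6, 12, 13} \<Longrightarrow> regs s' x = regs s x) \<Longrightarrow>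
      (regs s' 12 \<noteq> 0 \<longleftrightarrow> regs s 10 + 2 * 2 ^ floor_log k \<le> 2 * k) \<Longrightarrow> Q t s'"
  shows "wp inner_test Q s"
proof -
  define I where "I i s' \<longleftrightarrow> s' = s\<lparr>regs := (regs s)(13 := 2 ^ i, 6 := k)\<rparr>" for i s'
  show ?thesis
    unfolding inner_test_def
    apply (simp add: k(1)[symmetric])
    apply (rule wp_While_count[where I = I and N = "floor_log k" and T = 4])
    subgoal by (simp add: I_def)
    subgoal for i s'
      using le_floor_log_iff[OF k(2), of "Suc i"]
      by (auto simp: I_def fun_eq_iff)
    subgoal for s'
      using floor_log_exp2_gt[of k] by (auto simp: I_def)
    subgoal for t s'
      using floor_log_le[of k] k
      by (simp add: I_def) (rule post; auto)
    done
qed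

lemma wp_outer_test:
  assumes L: "0 < regs s 5"
    and post: "\<And>t s'. t \<le> 20 * regs s 10 + 50 \<Longrightarrow> mem s' = mem s \<Longrightarrow> out s' = out s \<Longrightarrow>
      (\<And>x. x \<notin> {6, 12, 13} \<Longrightarrow> regs s' x = regs s x) \<Longrightarrow>
      (regs s' 12 \<noteq> 0 \<longleftrightarrow> regs s 4 \<le> regs s 10 div regs s 5 + regs s 11) \<Longrightarrow> Q t s'"
  shows "wp outer_test Q s"
proof -
  define d where "d = regs s 10 div regs s 5"
  define I where "I i s' \<longleftrightarrow> s' = s\<lparr>regs := (regs s)(13 := i, 6 := regs s 10 - i * regs s 5)\<rparr>" for i s'
  have d: "d \<le> regs s 10" by (simp add: d_def)
  have more: "regs s 5 \<le> regs s 10 - i * regs s 5" if "i < d" for i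
  proof -
    have "Suc i * regs s 5 \<le> d * regs s 5" using that by (intro mult_right_mono) auto
    also have "\<dots> \<le> regs s 10" by (simp add: d_def)
    finally show ?thesis by simp
  qed
  have stop: "regs s 10 - d * regs s 5 < regs s 5"
    using L by (simp add: minus_div_mult_eq_mod d_def)
  show ?thesis
    unfolding outer_test_def
    apply simp
    apply (rule wp_While_count[where I = I and N = d and T = 8])
    subgoal by (simp add: I_def)
    subgoal for i s'
      using more[of i] by (auto simp: I_def fun_eq_iff)
    subgoal for s'
      using stop by (auto simp: I_def)
    subgoal for t s'
      using d by (simp add: I_def) (rule post; auto simp flip: d_def)
    done
qed

lemma wp_load_vertex:
  assumes "mem s 2 = fst r" "mem s 3 = snd r" "mem s (regs s 15) = fst v" "mem s (Suc (regs s 15)) = snd v"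
    and post: "\<And>t s'. t \<le> 50 \<Longrightarrow> mem s' = mem s \<Longrightarrow> out s' = out s \<Longrightarrow>
      (\<And>x. x \<notin> {8, 9, 10, 11} \<Longrightarrow> regs s' x = regs s x) \<Longrightarrow>
      regs s' 8 = fst v \<Longrightarrow> regs s' 9 = snd v \<Longrightarrow>
      regs s' 10 = fst (from_corner (regs s 3 < regs s 2) r v) \<Longrightarrow>
      regs s' 11 = snd (from_corner (regs s 3 < regs s 2) r v) \<Longrightarrow> Q t s'"
  shows "wp load_vertex Q s"
  unfolding load_vertex_def abs_diff_def
  by (simp add: assms(1-4)) (intro conjI impI; rule post; simp add: from_corner_def gap_def)

lemma wp_write_edge:
  assumes post: "\<And>t s'. t \<le> 50 \<Longrightarrow> s' = s\<lparr>out := out s @ [regs s 8, regs s 9] @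
      encode_vert (if (regs s 12 \<noteq> 0) = (regs s 3 < regs s 2)
        then (toward (mem s 2) (regs s 8), regs s 9) else (regs s 8, toward (mem s 3) (regs s 9)))\<rparr> \<Longrightarrow> Q t s'"
  shows "wp write_edge Q s"
  unfolding write_edge_def write_toward_def
  by simp (intro conjI impI; rule post; simp add: encode_vert_def toward_def)

text \<open>Both tests take time linear in the depth of the vertex, which \<open>D\<close>
  bounds.\<close>

lemma wp_process_vertex:
  assumes mem: "mem s 2 = fst r" "mem s 3 = snd r" "mem s (regs s 15) = fst v" "mem s (Suc (regs s 15)) = snd v"
    and L: "0 < regs s 5" and D: "gap (fst r) (fst v) + gap (snd r) (snd v) \<le> D"
    and post: "\<And>t s'. t \<le> 20 * D + 200 \<Longrightarrow> mem s' = mem s \<Longrightarrow> (\<And>x. x \<notin> {6..14} \<Longrightarrow> regs s' x = regs s x) \<Longrightarrow>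
      out s' = out s @ (if v = r then [] else encode_vert v @
        encode_vert (grid_parent (regs s 3 < regs s 2) (regs s 4) (regs s 5) r v)) \<Longrightarrow> Q t s'"
  shows "wp process_vertex Q s"
  unfolding process_vertex_def wp_Seq
proof (rule wp_load_vertex[OF mem])
  let ?sw = "regs s 3 < regs s 2"
  obtain i j where ij: "from_corner ?sw r v = (i, j)" by fastforce
  have sum: "i + j = gap (fst r) (fst v) + gap (snd r) (snd v)"
    using ij by (auto simp: from_corner_def split: if_splits)
  have root: "v = r \<longleftrightarrow> i + j = 0" unfolding sum by (auto simp: prod_eq_iff)
  fix t :: nat and s1 :: ram
  assume t: "t \<le> 50" and s1: "mem s1 = mem s" "out s1 = out s"
    "\<And>x. x \<notin> {8, 9, 10, 11} \<Longrightarrow> regs s1 x = regs s x" "regs s1 8 = fst v" "regs s1 9 = snd v"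
    and "regs s1 10 = fst (from_corner ?sw r v)" "regs s1 11 = snd (from_corner ?sw r v)"
  then have s1ij: "regs s1 10 = i" "regs s1 11 = j" by (simp_all add: ij)
  \<comment> \<open>Common continuation after either test; \<open>f\<close> adds the time already
    spent.\<close>
  have edge: "wp write_edge (\<lambda>u. Q (f u)) s2"
    if f: "\<And>u. u \<le> 50 \<Longrightarrow> f u \<le> 20 * D + 200" and s2: "mem s2 = mem s1" "out s2 = out s1"
      "\<And>x. x \<notin> {6, 12, 13} \<Longrightarrow> regs s2 x = regs s1 x"
      "regs s2 12 \<noteq> 0 \<longleftrightarrow> keeps_row (regs s 4) (regs s 5) i j" and nr: "v \<noteq> r"
    for f :: "nat \<Rightarrow> nat" and s2 :: ram
  proof (rule wp_write_edge, rule post)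
    fix u :: nat and s' :: ram assume u: "u \<le> 50" and s': "s' = s2\<lparr>out := out s2 @ [regs s2 8, regs s2 9] @
      encode_vert (if (regs s2 12 \<noteq> 0) = (regs s2 3 < regs s2 2)
        then (toward (mem s2 2) (regs s2 8), regs s2 9) else (regs s2 8, toward (mem s2 3) (regs s2 9)))\<rparr>"
    show "f u \<le> 20 * D + 200" by (rule f[OF u])
    show "mem s' = mem s" using s' s2 s1 by simp
    show "regs s' x = regs s x" if "x \<notin> {6..14}" for x
      using that s' s2(3)[of x] s1(3)[of x] by auto
    have regs: "regs s2 8 = fst v" "regs s2 9 = snd v" "regs s2 2 = regs s 2" "regs s2 3 = regs s 3"
      using s2(3) s1(3-5) by simp_all
    show "out s' = out s @ (if v = r then [] else encode_vert v @
        encode_vert (grid_parent ?sw (regs s 4) (regs s 5) r v))"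
      unfolding s' s2(4) using nr
      by (simp add: regs s2(1,2) s1(1,2) mem(1,2) grid_parent_def ij) (simp add: encode_vert_def)
  qed
  show "wp (IfNZ (Plus (Reg 10) (Reg 11))
       (Seq (IfNZ (Minus (Reg 4) (Plus (Reg 10) (Reg 11))) inner_test outer_test) write_edge)
       Skip) (\<lambda>u. Q (t + u)) s1"
  proof (cases "v = r")
    case True
    then have "i = 0" "j = 0" using root by auto
    then show ?thesis using True t s1ij by simp (rule post; use s1 in auto)
  next
    case False
    then have pos: "0 < i + j" using root by simp
    show ?thesis
      using pos s1ij s1(3)[of 4]
      apply simp
      apply (intro conjI impI)
      subgoal
        apply (rule wp_inner_test[where k = "i + j"])
        subgoal by simp
        subgoal by simp
        subgoal for u s2
          by (rule edge) (use False t D sum in \<open>auto simp: keeps_row_def\<close>)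
        done
      subgoal
        apply (rule wp_outer_test)
        subgoal using L s1(3)[of 5] by simp
        subgoal for u s2
          by (rule edge) (use False t D sum s1(3)[of 5] in \<open>auto simp: keeps_row_def\<close>)
        done
      done
  qed
qed

lemma wp_compute_sizes:
  assumes n: "n = min (regs s 2) (regs s 3)" "1 \<le> n"
    and post: "\<And>t s'. t \<le> 100 * n + 200 \<Longrightarrow> mem s' = mem s \<Longrightarrow> out s' = out s \<Longrightarrow>
      regs s' 2 = regs s 2 \<Longrightarrow> regs s' 3 = regs s 3 \<Longrightarrow>
      regs s' 4 = tri_size n \<Longrightarrow> regs s' 5 = block_size n \<Longrightarrow> Q t s'"
  shows "wp compute_sizes Q s"
proof -
  define frame where "frame s' \<longleftrightarrow> mem s' = mem s \<and> out s' = out s \<and>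
    regs s' 2 = regs s 2 \<and> regs s' 3 = regs s 3" for s' :: ram
  let ?a = "floor_log n"
  define I1 where "I1 i s' \<longleftrightarrow> frame s' \<and> regs s' 14 = n \<and> regs s' 6 = n div 2 ^ i \<and>
    regs s' 4 = 2 ^ i \<and> regs s' 7 = i" for i :: nat and s' :: ram
  define I2 where "I2 i s' \<longleftrightarrow> frame s' \<and> regs s' 14 = n \<and>
    regs s' 4 = 2 ^ (?a - i) \<and> regs s' 7 = ?a div 4 ^ i" for i :: nat and s' :: ram
  define I3 where "I3 i s' \<longleftrightarrow> frame s' \<and> regs s' 14 = n - i * tri_size n \<and>
    regs s' 4 = tri_size n \<and> regs s' 5 = i" for i :: nat and s' :: ram
  have loop1: "n div 2 ^ i div 2 \<noteq> 0 \<longleftrightarrow> i < ?a" for i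
    using le_floor_log_iff[of n "Suc i"] n(2)
    by (simp add: div_mult2_eq[symmetric] div_eq_0_iff mult.commute Suc_le_eq not_less)
  have loop2: "?a div 4 ^ i div 2 div 2 \<noteq> 0 \<longleftrightarrow> i < tri_exp n" for i
  proof (cases "?a = 0")
    case True
    then show ?thesis by (simp add: tri_exp_def)
  next
    case False
    have "(2::nat) ^ (2 * Suc i) = 4 ^ i * 2 * 2" by (simp only: power_mult) simp
    then have "?a div 4 ^ i div 2 div 2 = ?a div 2 ^ (2 * Suc i)"
      by (simp only: div_mult2_eq)
    moreover have "2 ^ (2 * Suc i) \<le> ?a \<longleftrightarrow> 2 * Suc i \<le> floor_log ?a"
      using False by (intro le_floor_log_iff) simp
    moreover have "2 * Suc i \<le> floor_log ?a \<longleftrightarrow> i < tri_exp n"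
      unfolding tri_exp_def by presburger
    ultimately show ?thesis by (simp add: div_eq_0_iff not_less)
  qed
  have half: "(2::nat) ^ (?a - i) div 2 = 2 ^ (?a - Suc i)" if "i < tri_exp n" for i
  proof -
    have "?a - i = Suc (?a - Suc i)" using that tri_exp_le[of n] by linarith
    then show ?thesis by simp
  qed
  \<comment> \<open>Truncated subtraction of \<open>tri_size n\<close> reaches zero exactly at the
    quotient rounded up.\<close>
  have loop3: "n - i * tri_size n \<noteq> 0 \<longleftrightarrow> i < block_size n" for i
  proof -
    have "i < block_size n \<longleftrightarrow> Suc i * tri_size n \<le> n + tri_size n - 1"
      unfolding block_size_def using tri_size_bounds(2)[OF n(2)]
      by (simp add: less_eq_div_iff_mult_less_eq Suc_le_eq[symmetric])
    then show ?thesis using tri_size_bounds(2)[OF n(2)] by auto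
  qed
  have cnt: "?a \<le> n" "tri_exp n \<le> n" "block_size n \<le> n + 1"
  proof -
    show a: "?a \<le> n" by (rule floor_log_le)
    show "tri_exp n \<le> n" using a tri_exp_le[of n] by linarith
    have "block_size n * 1 \<le> n + 1"
    proof (rule ccontr)
      assume "\<not> block_size n * 1 \<le> n + 1"
      then have "n < block_size n - 1" by simp
      moreover have "(block_size n - 1) * tri_size n < n"
        using loop3[of "block_size n - 1"] block_size_bounds(1)[OF n(2)] by auto
      moreover have "(block_size n - 1) * 1 \<le> (block_size n - 1) * tri_size n"
        using tri_size_bounds(2)[OF n(2)] by (intro mult_left_mono) auto
      ultimately show False by linarith
    qed
    then show "block_size n \<le> n + 1" by simp
  qed
  have step1: "aval (Half (Reg 6)) s' \<noteq> 0 \<and>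
      wp (Seq (Assign 6 (Half (Reg 6))) (Seq (Assign 4 (Plus (Reg 4) (Reg 4)))
        (Assign 7 (Plus (Reg 7) (Const 1))))) (\<lambda>t s'. t \<le> 20 \<and> I1 (Suc i) s') s'"
    if "I1 i s'" "i < ?a" for i :: nat and s' :: ram
    using that loop1[of i] by (simp add: I1_def frame_def div_mult2_eq[symmetric] mult.commute)
  have step2: "aval (Half (Half (Reg 7))) s' \<noteq> 0 \<and>
      wp (Seq (Assign 7 (Half (Half (Reg 7)))) (Assign 4 (Half (Reg 4))))
        (\<lambda>t s'. t \<le> 20 \<and> I2 (Suc i) s') s'"
    if "I2 i s'" "i < tri_exp n" for i :: nat and s' :: ram
    using that loop2[of i] half[of i]
    by (simp add: I2_def frame_def div_mult2_eq[symmetric] mult.commute)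
  have step3: "aval (Reg 14) s' \<noteq> 0 \<and>
      wp (Seq (Assign 14 (Minus (Reg 14) (Reg 4))) (Assign 5 (Plus (Reg 5) (Const 1))))
        (\<lambda>t s'. t \<le> 20 \<and> I3 (Suc i) s') s'"
    if "I3 i s'" "i < block_size n" for i :: nat and s' :: ram
    using that loop3[of i] by (simp add: I3_def frame_def)
  \<comment> \<open>The program is cut before the later loops, so that each loop is treated
    separately with the time \<open>t0\<close> spent so far.\<close>
  define rest2 where "rest2 = Seq (Assign 5 (Const 0))
         (WhileNZ (Reg 14)
            (Seq (Assign 14 (Minus (Reg 14) (Reg 4)))
                 (Assign 5 (Plus (Reg 5) (Const 1)))))"
  define rest1 where "rest1 = Seq (WhileNZ (Half (Half (Reg 7)))
            (Seq (Assign 7 (Half (Half (Reg 7))))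
                 (Assign 4 (Half (Reg 4))))) rest2"
  have r2: "wp rest2 (\<lambda>t. Q (t0 + t)) s'"
    if "frame s'" "regs s' 14 = n" "regs s' 4 = tri_size n" "t0 \<le> 70 * n + 100" for t0 s'
    unfolding rest2_def wp_Seq wp_Assign
  proof (rule wp_While_count[where I = I3 and N = "block_size n" and T = 20, OF _ step3])
    fix t s2
    assume t: "t \<le> block_size n * (acost (Reg 14) + 1 + 20) + (acost (Reg 14) + 1)"
      and I: "I3 (block_size n) s2"
    show "Q (t0 + (acost (Const 0) + 1 + t)) s2"
      by (rule post) (use I t cnt(3) that(4) in \<open>auto simp: I3_def frame_def\<close>)
  qed (use that loop3[of "block_size n"] in \<open>auto simp: I3_def frame_def\<close>)
  have r1: "wp rest1 (\<lambda>t. Q (t0 + t)) s'"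
    if "I1 ?a s'" "t0 \<le> 30 * n + 50" for t0 s'
    unfolding rest1_def wp_Seq
  proof (rule wp_While_count[where I = I2 and N = "tri_exp n" and T = 20, OF _ step2])
    fix t s2
    assume t: "t \<le> tri_exp n * (acost (Half (Half (Reg 7))) + 1 + 20) + (acost (Half (Half (Reg 7))) + 1)"
      and I: "I2 (tri_exp n) s2"
    have "wp rest2 (\<lambda>u. Q ((t0 + t) + u)) s2"
      by (rule r2) (use I t cnt(2) that(2) in \<open>auto simp: I2_def tri_size_def\<close>)
    then show "wp rest2 (\<lambda>u. Q (t0 + (t + u))) s2" by (simp only: add.assoc)
  qed (use that loop2[of "tri_exp n"] in \<open>auto simp: I1_def I2_def frame_def\<close>)
  define loop where "loop = WhileNZ (Half (Reg 6))
            (Seq (Assign 6 (Half (Reg 6)))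
            (Seq (Assign 4 (Plus (Reg 4) (Reg 4)))
                 (Assign 7 (Plus (Reg 7) (Const 1)))))"
  have r0: "wp loop (\<lambda>t. wp rest1 (\<lambda>u. Q (f t u))) s'"
    if "I1 0 s'" and f: "\<And>t u. f t u = c + t + u" "c \<le> 20" for f c s'
    unfolding loop_def f
  proof (rule wp_While_count[where I = I1 and N = ?a and T = 20, OF that(1) step1])
    fix t s2
    assume t: "t \<le> ?a * (acost (Half (Reg 6)) + 1 + 20) + (acost (Half (Reg 6)) + 1)"
      and I: "I1 ?a s2"
    show "wp rest1 (\<lambda>u. Q (c + t + u)) s2"
      by (rule r1) (use I t cnt(1) that(3) in auto)
  qed (use loop1[of ?a] in \<open>auto simp: I1_def\<close>)
  show ?thesis
    unfolding compute_sizes_def rest2_def[symmetric] rest1_def[symmetric] loop_def[symmetric]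
    \<comment> \<open>The straight-line prefix takes 6 units for the minimum and 2 for each of three
      assignments, 12 in total.\<close>
    by (simp del: wp_If add: wp_If[of "Minus (Reg 2) (Reg 3)"])
      (intro conjI impI; rule r0[where c = 12]; use n in \<open>simp add: I1_def frame_def\<close>)
qed

text \<open>The side lengths are not part of the input; they are recovered as one plus the largest
  coordinates, which are attained by assumption.\<close>

lemma wp_scan_dimensions:
  assumes N: "mem s 0 = N"
    and x: "\<And>t. t < N \<Longrightarrow> mem s (2 * t + 4) < n" "\<exists>t<N. mem s (2 * t + 4) = n - 1"
    and y: "\<And>t. t < N \<Longrightarrow> mem s (Suc (2 * t + 4)) < m" "\<exists>t<N. mem s (Suc (2 * t + 4)) = m - 1"
    and init: "regs s 2 = 0" "regs s 3 = 0"
    and post: "\<And>t s'. t \<le> 60 * N + 20 \<Longrightarrow> mem s' = mem s \<Longrightarrow> out s' = out s \<Longrightarrow>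
      regs s' 2 = n \<Longrightarrow> regs s' 3 = m \<Longrightarrow> Q t s'"
  shows "wp scan_dimensions Q s"
proof -
  define I where "I i s' \<longleftrightarrow> mem s' = mem s \<and> out s' = out s \<and> regs s' 0 = N - i \<and>
    regs s' 15 = 2 * i + 4 \<and> regs s' 2 \<le> n \<and> regs s' 3 \<le> m \<and>
    (\<forall>t<i. mem s (2 * t + 4) < regs s' 2 \<and> mem s (Suc (2 * t + 4)) < regs s' 3)" for i :: nat and s' :: ram
  show ?thesis
    unfolding scan_dimensions_def wp_Seq wp_Assign
  proof (rule wp_While_count[where I = I and N = N and T = 50])
    fix i s'
    assume I: "I i s'" and i: "i < N"
    have mem: "mem s' (regs s' 15) = mem s (2 * i + 4)" "mem s' (Suc (regs s' 15)) = mem s (Suc (2 * i + 4))"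
      using I by (simp_all add: I_def)
    have "aval (Reg 0) s' \<noteq> 0" using I i by (simp add: I_def)
    moreover have "wp (Seq (IfNZ (Minus (Plus (Mem (Reg 15)) (Const 1)) (Reg 2))
              (Assign 2 (Plus (Mem (Reg 15)) (Const 1))) Skip)
      (Seq (IfNZ (Minus (Plus (Mem (Plus (Reg 15) (Const 1))) (Const 1)) (Reg 3))
              (Assign 3 (Plus (Mem (Plus (Reg 15) (Const 1))) (Const 1))) Skip)
      (Seq (Assign 15 (Plus (Reg 15) (Const 2)))
           (Assign 0 (Minus (Reg 0) (Const 1)))))) (\<lambda>t s'. t \<le> 50 \<and> I (Suc i) s') s'"
      using I x(1)[OF i] y(1)[OF i] by (auto simp: mem I_def less_Suc_eq)
    ultimately show "aval (Reg 0) s' \<noteq> 0 \<and> wp (Seq (IfNZ (Minus (Plus (Mem (Reg 15)) (Const 1)) (Reg 2))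
              (Assign 2 (Plus (Mem (Reg 15)) (Const 1))) Skip)
      (Seq (IfNZ (Minus (Plus (Mem (Plus (Reg 15) (Const 1))) (Const 1)) (Reg 3))
              (Assign 3 (Plus (Mem (Plus (Reg 15) (Const 1))) (Const 1))) Skip)
      (Seq (Assign 15 (Plus (Reg 15) (Const 2)))
           (Assign 0 (Minus (Reg 0) (Const 1)))))) (\<lambda>t s'. t \<le> 50 \<and> I (Suc i) s') s'" by blast
  next
    fix t s'
    assume t: "t \<le> N * (acost (Reg 0) + 1 + 50) + (acost (Reg 0) + 1)" and I: "I N s'"
    show "Q (acost (Mem (Const 0)) + 1 + (acost (Const 4) + 1 + t)) s'"
    proof (rule post)
      from x(2) obtain u where "u < N" "mem s (2 * u + 4) = n - 1" by blast
      with I have "n - 1 < regs s' 2" "regs s' 2 \<le> n" by (auto simp: I_def)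
      then show "regs s' 2 = n" by simp
      from y(2) obtain u where "u < N" "mem s (Suc (2 * u + 4)) = m - 1" by blast
      with I have "m - 1 < regs s' 3" "regs s' 3 \<le> m" by (auto simp: I_def)
      then show "regs s' 3 = m" by simp
    qed (use t I in \<open>auto simp: I_def\<close>)
  qed (use N init in \<open>auto simp: I_def\<close>)
qed

section \<open>Input layout and correctness of the whole program\<close>

lemma encode_edges_append: "encode_edges (xs @ ys) = encode_edges xs @ encode_edges ys"
  by (simp add: encode_edges_def)

lemma encode_vertices_nth:
  "t < length vs \<Longrightarrow> concat (map encode_vert vs) ! (2 * t) = fst (vs ! t) \<and>
     concat (map encode_vert vs) ! (Suc (2 * t)) = snd (vs ! t)"
proof (induction vs arbitrary: t)
  case (Cons v vs)
  then show ?case by (cases t) (auto simp: encode_vert_def)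
qed simp

lemma length_encode_vertices: "length (concat (map encode_vert vs)) = 2 * length vs"
  by (induction vs) (auto simp: encode_vert_def)

text \<open>Four header words, the two lengths and the root, precede the vertices, so vertex
  \<open>t\<close> starts at address \<open>2 * t + 4\<close>.\<close>

lemma initial_mem:
  fixes r :: "nat \<times> nat" and vs es
  defines "M \<equiv> mem (initial (encode_rooted_graph vs es r))"
  shows "M 0 = length vs" "M 2 = fst r" "M 3 = snd r"
    "t < length vs \<Longrightarrow> M (2 * t + 4) = fst (vs ! t)"
    "t < length vs \<Longrightarrow> M (Suc (2 * t + 4)) = snd (vs ! t)"
proof -
  have xs: "encode_rooted_graph vs es r =
      length vs # length es # fst r # snd r # (concat (map encode_vert vs) @ encode_edges es)"
    by (simp add: encode_rooted_graph_def encode_vert_def)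
  show "M 0 = length vs" "M 2 = fst r" "M 3 = snd r"
    by (simp_all add: M_def initial_def xs numeral_eq_Suc)
  assume t: "t < length vs"
  have "M (k + 4) = (concat (map encode_vert vs)) ! k" if "k < 2 * length vs" for k
    using that length_encode_vertices[of vs]
    by (simp add: M_def initial_def xs numeral_eq_Suc nth_append)
  from this[of "2 * t"] this[of "2 * t + 1"] encode_vertices_nth[OF t] t
  show "M (2 * t + 4) = fst (vs ! t)" "M (Suc (2 * t + 4)) = snd (vs ! t)"
    by (simp_all add: numeral_eq_Suc)
qed

context rooted_grid
begin

definition tree_edges :: "(nat \<times> nat) list \<Rightarrow> ((nat \<times> nat) \<times> (nat \<times> nat)) list" where
  "tree_edges vs = map (\<lambda>v. (v, grid_parent sw (tri_size n) (block_size n) r v)) (filter (\<lambda>v. v \<noteq> r) vs)"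

text \<open>Each of the \<open>N\<close> vertices costs time linear in its depth, hence
  \<open>O(N)\<close>, and \<open>N\<close> is bounded by the input length; this gives the quadratic
  bound.\<close>

lemma tree_program_correct:
  assumes vs: "distinct vs" "set vs = V"
  shows "\<exists>t. halts_with tree_program (encode_rooted_graph vs es r) t (encode_edges (tree_edges vs)) \<and>
    t \<le> 1000 * (length (encode_rooted_graph vs es r))\<^sup>2"
proof -
  define s0 where "s0 = initial (encode_rooted_graph vs es r)"
  define N where "N = length vs"
  define l where "l = length (encode_rooted_graph vs es r)"
  have Nnm: "N = n0 * m0"
    using distinct_card[OF vs(1)] vs(2) by (simp add: N_def grid_verts_def card_cartesian_product)
  note mem0 = initial_mem[where vs = vs and es = es and r = r, folded s0_def N_def]
  have init: "regs s0 x = 0" "out s0 = []" for x by (simp_all add: s0_def initial_def)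
  have inV: "fst (vs ! t) < n0" "snd (vs ! t) < m0" if "t < N" for t
  proof -
    have "vs ! t \<in> V" using nth_mem[of t vs] that vs(2) by (simp only: N_def)
    then show "fst (vs ! t) < n0" "snd (vs ! t) < m0" by (auto simp: grid_verts_def mem_Times_iff)
  qed
  \<comment> \<open>This far corner attains both maximal coordinates sought by the scan.\<close>
  have "(n0 - 1, m0 - 1) \<in> set vs" using vs(2) n0_pos m0_pos by (auto simp: grid_verts_def)
  then obtain c where c: "c < N" "vs ! c = (n0 - 1, m0 - 1)" by (auto simp: in_set_conv_nth N_def)
  have l: "2 * N + 4 \<le> l"
    using length_encode_vertices[of vs] by (simp add: l_def N_def encode_rooted_graph_def encode_vert_def)
  have "n0 * 1 \<le> N" "1 * m0 \<le> N"
    unfolding Nnm using n0_pos m0_pos by (intro mult_mono; simp)+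
  then have n0N: "n0 \<le> N" and m0N: "m0 \<le> N" by auto
  have nN: "n \<le> N" using n0N by (simp add: n_def)
  define I where "I i s \<longleftrightarrow> mem s = mem s0 \<and> regs s 0 = N - i \<and> regs s 15 = 2 * i + 4 \<and>
    regs s 2 = n0 \<and> regs s 3 = m0 \<and> regs s 4 = tri_size n \<and> regs s 5 = block_size n \<and>
    out s = encode_edges (tree_edges (take i vs))" for i :: nat and s :: ram
  let ?body = "Seq process_vertex (Seq (Assign 15 (Plus (Reg 15) (Const 2))) (Assign 0 (Minus (Reg 0) (Const 1))))"
  let ?T = "20 * (2 * N) + 250"
  have step: "aval (Reg 0) s \<noteq> 0 \<and> wp ?body (\<lambda>t s'. t \<le> ?T \<and> I (Suc i) s') s"
    if I: "I i s" and i: "i < N" for i s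
  proof
    show "aval (Reg 0) s \<noteq> 0" using I i by (simp add: I_def)
    show "wp ?body (\<lambda>t s'. t \<le> ?T \<and> I (Suc i) s') s"
      unfolding wp_Seq[of process_vertex]
    proof (rule wp_process_vertex[where r = r and v = "vs ! i" and D = "2 * N"])
      have "gap (fst r) (fst (vs ! i)) \<le> n0" "gap (snd r) (snd (vs ! i)) \<le> m0"
        using inV[OF i] root_in by (auto simp: gap_def grid_verts_def)
      then show "gap (fst r) (fst (vs ! i)) + gap (snd r) (snd (vs ! i)) \<le> 2 * N"
        using n0N m0N by simp
    next
      fix t :: nat and s' :: ram
      assume t: "t \<le> 20 * (2 * N) + 200" and s': "mem s' = mem s"
        "\<And>x. x \<notin> {6..14} \<Longrightarrow> regs s' x = regs s x"
        "out s' = out s @ (if vs ! i = r then [] else encode_vert (vs ! i) @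
          encode_vert (grid_parent (regs s 3 < regs s 2) (regs s 4) (regs s 5) r (vs ! i)))"
      have "take (Suc i) vs = take i vs @ [vs ! i]"
        using i by (simp add: N_def take_Suc_conv_app_nth)
      then have "out s' = encode_edges (tree_edges (take (Suc i) vs))"
        using s'(3) I by (simp add: I_def tree_edges_def encode_edges_append sw_def)
          (simp add: encode_edges_def)
      then show "wp (Seq (Assign 15 (Plus (Reg 15) (Const 2))) (Assign 0 (Minus (Reg 0) (Const 1))))
          (\<lambda>u s'. t + u \<le> ?T \<and> I (Suc i) s') s'"
        using t s'(1,2) I by (simp add: I_def)
    qed (use I mem0 i block_size_bounds(1)[OF nm(1)] in \<open>auto simp: I_def\<close>)
  qed
  have "wp tree_program (\<lambda>t s. t \<le> 1000 * l\<^sup>2 \<and> out s = encode_edges (tree_edges vs)) s0"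
    unfolding tree_program_def wp_Seq
  proof (rule wp_scan_dimensions[where N = N and n = n0 and m = m0])
    fix t1 :: nat and s1 :: ram
    assume t1: "t1 \<le> 60 * N + 20" and s1: "mem s1 = mem s0" "out s1 = out s0" "regs s1 2 = n0" "regs s1 3 = m0"
    show "wp compute_sizes (\<lambda>t. wp (Assign 0 (Mem (Const 0))) (\<lambda>ta. wp (Assign 15 (Const 4))
      (\<lambda>tb. wp (WhileNZ (Reg 0) ?body) (\<lambda>u s. t1 + (t + (ta + (tb + u))) \<le> 1000 * l\<^sup>2 \<and>
        out s = encode_edges (tree_edges vs))))) s1"
    proof (rule wp_compute_sizes[where n = n])
      fix t2 :: nat and s2 :: ram
      assume t2: "t2 \<le> 100 * n + 200" and s2: "mem s2 = mem s1" "out s2 = out s1"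
        "regs s2 2 = regs s1 2" "regs s2 3 = regs s1 3" "regs s2 4 = tri_size n" "regs s2 5 = block_size n"
      show "wp (Assign 0 (Mem (Const 0))) (\<lambda>ta. wp (Assign 15 (Const 4))
        (\<lambda>tb. wp (WhileNZ (Reg 0) ?body) (\<lambda>u s. t1 + (t2 + (ta + (tb + u))) \<le> 1000 * l\<^sup>2 \<and>
          out s = encode_edges (tree_edges vs)))) s2"
        unfolding wp_Assign
      proof (rule wp_While_count[where I = I and N = N and T = ?T, OF _ step])
        fix u :: nat and s :: ram
        assume u: "u \<le> N * (acost (Reg 0) + 1 + ?T) + (acost (Reg 0) + 1)" and I: "I N s"
        have lN: "N * l \<le> l * l" "4 * l \<le> l * l" "4 * 4 \<le> l * l" "N * N \<le> N * l"
          using l by (intro mult_mono; simp)+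
        have "N * 4 \<le> N * l" using l by (intro mult_left_mono) auto
        then have "u \<le> 40 * (N * N) + 252 * N + 2" using u by (simp add: algebra_simps)
        then have "t1 + (t2 + (acost (Mem (Const 0)) + 1 + (acost (Const 4) + 1 + u))) \<le> 1000 * (l * l)"
          using t1 t2 lN l nN by (simp only: acost.simps)
        then show "t1 + (t2 + (acost (Mem (Const 0)) + 1 + (acost (Const 4) + 1 + u))) \<le> 1000 * l\<^sup>2 \<and>
            out s = encode_edges (tree_edges vs)"
          using I by (simp add: power2_eq_square I_def N_def)
      qed (use s1 s2 mem0 init in \<open>auto simp: I_def tree_edges_def encode_edges_def\<close>)
    qed (use nm s1 in \<open>auto simp: n_def\<close>)
  next
    show "\<exists>t<N. mem s0 (2 * t + 4) = n0 - 1" using c mem0(4)[OF c(1)] by auto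
    show "\<exists>t<N. mem s0 (Suc (2 * t + 4)) = m0 - 1" using c mem0(5)[OF c(1)] by auto
  qed (use mem0 inV init in auto)
  then show ?thesis by (auto simp: wp_def halts_with_def s0_def l_def)
qed

lemma tree_edges_listing:
  assumes "distinct vs" "set vs = V"
  shows "edge_listing (tree_edges vs)
    (parent_map.parent_edges V r (grid_parent sw (tri_size n) (block_size n) r))"
proof -
  interpret rooted_grid_tree n0 m0 r "tri_size n" "block_size n" by (rule tri_size_tree)
  have eq: "map (\<lambda>(u, v). {u, v}) (tree_edges vs) = map (\<lambda>v. {v, par v}) (filter (\<lambda>v. v \<noteq> r) vs)"
    by (simp add: tree_edges_def)
  have set: "set (filter (\<lambda>v. v \<noteq> r) vs) = V - {r}" using assms(2) by auto
  show ?thesis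
    unfolding edge_listing_def eq distinct_map set_map set parent_edges_def
    using assms(1) parent_edge_inj by simp
qed

end

theorem theorem3:
  shows "\<exists>(A :: com) (q :: nat poly) (\<epsilon> :: nat \<Rightarrow> real).
    \<epsilon> \<longlonglongrightarrow> 0 \<and>
    (\<forall>(n :: nat) (m :: nat) (r :: nat \<times> nat) (vs :: (nat \<times> nat) list)
       (es :: ((nat \<times> nat) \<times> (nat \<times> nat)) list).
      1 \<le> n \<and> 1 \<le> m \<and> r \<in> grid_corners n m \<and>
      distinct vs \<and> set vs = grid_verts n m \<and> edge_listing es (grid_edges n m) \<longrightarrow>
      (\<exists>(t :: nat) (fs :: ((nat \<times> nat) \<times> (nat \<times> nat)) list) (F :: (nat \<times> nat) set set).
        halts_with A (encode_rooted_graph vs es r) t (encode_edges fs) \<and>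
        t \<le> poly q (length (encode_rooted_graph vs es r)) \<and>
        edge_listing fs F \<and>
        spanning_tree (grid_verts n m) (grid_edges n m) F \<and>
        ednr_loss (grid_verts n m) r (\<lambda>_. 1) (\<lambda>_. 1) F
          \<le> (9 / 8 + \<epsilon> (min n m)) *
             ednr_opt (grid_verts n m) (grid_edges n m) r (\<lambda>_. 1) (\<lambda>_. 1)))"
proof (rule exI[of _ tree_program], rule exI[of _ "[:0, 0, 1000:]"], rule exI[of _ approx_error],
    intro conjI allI impI)
  show "approx_error \<longlonglongrightarrow> 0" by (rule approx_error_tendsto_0)
next
  fix n m :: nat and r :: "nat \<times> nat" and vs :: "(nat \<times> nat) list"
    and es :: "((nat \<times> nat) \<times> (nat \<times> nat)) list"
  assume a: "1 \<le> n \<and> 1 \<le> m \<and> r \<in> grid_corners n m \<and>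
      distinct vs \<and> set vs = grid_verts n m \<and> edge_listing es (grid_edges n m)"
  interpret G: rooted_grid n m r using a by unfold_locales auto
  interpret G: rooted_grid_tree n m r "tri_size G.n" "block_size G.n" by (rule G.tri_size_tree)
  obtain t where t: "halts_with tree_program (encode_rooted_graph vs es r) t (encode_edges (G.tree_edges vs))"
    "t \<le> 1000 * (length (encode_rooted_graph vs es r))\<^sup>2"
    using G.tree_program_correct[of vs es] a by blast
  \<comment> \<open>The coefficient list represents \<open>1000 * x^2\<close>.\<close>
  have "t \<le> poly [:0, 0, 1000:] (length (encode_rooted_graph vs es r))"
    using t(2) by (simp add: power2_eq_square)
  moreover have "edge_listing (G.tree_edges vs) G.parent_edges"
    using G.tree_edges_listing a by blast
  moreover have "ednr_loss (grid_verts n m) r (\<lambda>_. 1) (\<lambda>_. 1) G.parent_edges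
      \<le> (9 / 8 + approx_error (min n m)) * ednr_opt (grid_verts n m) (grid_edges n m) r (\<lambda>_. 1) (\<lambda>_. 1)"
    using G.tri_size_tree_loss by (simp only: G.n_def)
  ultimately show "\<exists>t fs F. halts_with tree_program (encode_rooted_graph vs es r) t (encode_edges fs) \<and>
        t \<le> poly [:0, 0, 1000:] (length (encode_rooted_graph vs es r)) \<and>
        edge_listing fs F \<and>
        spanning_tree (grid_verts n m) (grid_edges n m) F \<and>
        ednr_loss (grid_verts n m) r (\<lambda>_. 1) (\<lambda>_. 1) F
          \<le> (9 / 8 + approx_error (min n m)) *
             ednr_opt (grid_verts n m) (grid_edges n m) r (\<lambda>_. 1) (\<lambda>_. 1)"
    using t(1) G.grid_tree_spanning by blast
qed

end
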